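(* Assume that for some constants $\gamma\ge 0$ and $\omega'\in[0,\omega)$ one has $$M b e^{\omega\tau}\int_0^t|\alpha(s+\tau)|\,ds\le \gamma+\omega' t\qquad\text{for all } t>0,$$ and that $\int_{t-\tau}^t|\alpha(s)|\,ds\le\sigma$ for all $t\ge 0$, for some $\sigma>0$. Then there exist $\rho>0$ and $C_\rho>0$ with $$L(C_\rho)<\frac{\omega-\omega'}{M(1+e^{\omega\tau})}$$ such that, if $\Phi=(f_0,g_0)\in C([-\tau,0];\mathcal H)$, with $u_0:=f_0(0)$, $u_1:=g_0(0)$, satisfies $$\|u_1\|^2+\|\sqrt A u_0\|^2+\int_{-\tau}^0\|\nabla\psi_2(f_0(s))\|^2ds+\int_{-\tau}^0|\alpha(s+\tau)|\,\|B^*g_0(s)\|^2ds<\rho^2$$ and $$\max_{s\in[-\tau,0]}\|\Phi(s)\|_{\mathcal H}<\rho,$$ then the abstract problem $U_t(t)=\mathscr A U(t)+\alpha(t)\mathscr B U(t-\tau)+F(U(t),U(t-\tau))$, $t>0$, $U=\Phi$ on $[-\tau,0]$, has a unique global solution, and this solution satisfies $\|U(t)\|_{\mathcal H}\le C_\rho$ for all $t\ge 0$.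
   Context: Setting. $H$ is a real Hilbert space with inner product $\langle\cdot,\cdot\rangle$ and norm $\|\cdot\|$; $A:D(A)\to H$ is a positive self-adjoint linear operator with dense domain $D(A)\subset H$; $\tau>0$ is a delay; $W$ is a real Hilbert space identified with its dual; $C:W\to H$ and $B:H\to H$ are bounded linear operators with adjoints $C^*$, $B^*$; $\alpha\in L^1_{loc}([0,+\infty))$ satisfies $\int_{t-\tau}^t|\alpha(s)|ds\le\sigma$ for all $t\ge0$ and some $\sigma>0$ ($\alpha$ being understood as $0$ on negative times). Observability assumption: there are $T_0>0$ and $c>0$ such that every solution of $w_{tt}+Aw+CC^*w_t=0$, $w(0)=w_0$, $w_t(0)=w_1$, satisfies $\int_0^{T_0}\|C^*w_t(t)\|_W^2dt\ge c(\|w_1\|^2+\|\sqrt A w_0\|^2)$. Nonlinearities. $\psi_1,\psi_2:D(\sqrt A)\to\mathbb R$ are functionals with Gateaux derivatives $D\psi_i(u)$, such that: - for every $u\in D(\sqrt A)$ there is $c(u)>0$ with $|D\psi_i(u)(v)|\le c(u)\|v\|$ for all $v\in D(\sqrt A)$, $i=1,2$; then $D\psi_i(u)$ extends to $H$ and $\nabla\psi_i(u)\in H$ denotes its Riesz representative, $\langle\nabla\psi_i(u),v\rangle=D\psi_i(u)(v)$; - for all $R>0$ there is $L(R)>0$ with $\|\nabla\psi_i(u)-\nabla\psi_i(v)\|\le L(R)\|\sqrt A(u-v)\|$ whenever $u,v\in D(\sqrt A)$, $\|\sqrt A u\|\le R$, $\|\sqrt A v\|\le R$, $i=1,2$, and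 $L(R)\to0$ as $R\to0$; - $\psi_i(0)=0$, $\nabla\psi_i(0)=0$ for $i=1,2$, and there is a strictly increasing continuous function $h_1:[0,\infty)\to\mathbb R$ with $|\langle\nabla\psi_1(u),u\rangle|\le h_1(\|\sqrt A u\|)\|\sqrt A u\|^2$ for all $u\in D(\sqrt A)$. Abstract form. $\mathcal H=D(\sqrt A)\times H$ is a Hilbert space with inner product $\langle(u_1,v_1),(u_2,v_2)\rangle_{\mathcal H}=\langle\sqrt A u_1,\sqrt A u_2\rangle+\langle v_1,v_2\rangle$. Put $\mathscr A(u,v)=(v,-Au-CC^*v)$, $\mathscr B(u,v)=(0,-BB^*v)$, and $F(U(t),U(t-\tau))=(0,\nabla\psi_1(u(t))+\nabla\psi_2(u(t-\tau)))$ for $U=(u,v)$, and $b=\|\mathscr B\|=\|BB^*\|$. Under the observability assumption $\mathscr A$ generates an exponentially stable $C_0$-semigroup $(S(t))_{t\ge0}$ on $\mathcal H$; $M,\omega>0$ are fixed constants with $\|S(t)\|_{\mathcal L(\mathcal H)}\le Me^{-\omega t}$ for all $t\ge0$. The map $F$ satisfies $F(0,0)=0$ and $\|F(U_1,U_1^\tau)-F(U_2,U_2^\tau)\|_{\mathcal H}\le L(R)(\|U_1-U_2\|_{\mathcal H}+\|U_1^\tau-U_2^\tau\|_{\mathcal H})$ when all four arguments have norm at most $R$, with the same symbol $L$, $L(R)\to0$ as $R\to0$. A solution is a continuous $\mathcal H$-valued function with $U=\Phi$ on $[-\tau,0]$ and $U(t)=S(t)U_0+\int_0^tS(t-s)[\alpha(s)\mathscr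 B U(s-\tau)+F(U(s),U(s-\tau))]ds$ for $t\ge0$, where $U_0=U(0)=\Phi(0)$. *)

theory Defs
  imports "HOL-Analysis.Analysis"
begin

text \<open>Hilbert spaces are types of sort \<open>{real_inner, complete_space}\<close>; separability is not assumed.
  An unbounded operator is a total function together with its domain; its values outside the
  domain are irrelevant.\<close>

definition linear_map_on :: "'a::real_vector set \<Rightarrow> ('a \<Rightarrow> 'b::real_vector) \<Rightarrow> bool" where
  "linear_map_on V f \<longleftrightarrow>
     (\<forall>x\<in>V. \<forall>y\<in>V. f (x + y) = f x + f y) \<and> (\<forall>c. \<forall>x\<in>V. f (c *\<^sub>R x) = c *\<^sub>R f x)"

text \<open>The last conjunct says that the graph of the adjoint, i.e. the set of pairs \<open>(y, z)\<close> with
  \<open>A x \<bullet> y = x \<bullet> z\<close> for all \<open>x\<close> in \<open>D\<close>, coincides with the graph of \<open>A\<close>.\<close>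

definition self_adjoint_on :: "'h::{real_inner,complete_space} set \<Rightarrow> ('h \<Rightarrow> 'h) \<Rightarrow> bool" where
  "self_adjoint_on D A \<longleftrightarrow> subspace D \<and> closure D = UNIV \<and> linear_map_on D A \<and>
     (\<forall>y z. (\<forall>x\<in>D. A x \<bullet> y = x \<bullet> z) \<longleftrightarrow> y \<in> D \<and> z = A y)"

definition positive_self_adjoint :: "'h::{real_inner,complete_space} set \<Rightarrow> ('h \<Rightarrow> 'h) \<Rightarrow> bool" where
  "positive_self_adjoint D A \<longleftrightarrow> self_adjoint_on D A \<and> (\<forall>u\<in>D. u \<noteq> 0 \<longrightarrow> A u \<bullet> u > 0)"

text \<open>The operator \<open>R\<close> with domain \<open>DR\<close> is the (unique) nonnegative self-adjoint operator with
  \<open>R\<^sup>2 = A\<close>, where the equality includes that of the domains.\<close>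

definition op_sqrt_of ::
    "'h::{real_inner,complete_space} set \<Rightarrow> ('h \<Rightarrow> 'h) \<Rightarrow> 'h set \<Rightarrow> ('h \<Rightarrow> 'h) \<Rightarrow> bool" where
  "op_sqrt_of DA A DR R \<longleftrightarrow> self_adjoint_on DR R \<and> (\<forall>u\<in>DR. R u \<bullet> u \<ge> 0) \<and>
     DA = {u\<in>DR. R u \<in> DR} \<and> (\<forall>u\<in>DA. R (R u) = A u)"

text \<open>The energy space \<open>D(\<surd>A) \<times> H\<close> carries the inner product \<open>energy_inner\<close>, not the one of the
  product type. The map \<open>energy_map R\<close>, \<open>(u, v) \<mapsto> (\<surd>A u, v)\<close>, is a linear isometry from it into
  \<open>H \<times> H\<close> (see the lemmas below), so limits, continuity, completeness and integrals with respect
  to the energy norm are expressed through that map.\<close>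

definition energy_space :: "'h set \<Rightarrow> ('h \<times> 'h) set" where
  "energy_space DR = DR \<times> UNIV"

definition energy_inner :: "('h::real_inner \<Rightarrow> 'h) \<Rightarrow> 'h \<times> 'h \<Rightarrow> 'h \<times> 'h \<Rightarrow> real" where
  "energy_inner R U V = R (fst U) \<bullet> R (fst V) + snd U \<bullet> snd V"

definition energy_norm :: "('h::real_inner \<Rightarrow> 'h) \<Rightarrow> 'h \<times> 'h \<Rightarrow> real" where
  "energy_norm R U = sqrt (energy_inner R U U)"

definition energy_map :: "('h \<Rightarrow> 'h) \<Rightarrow> 'h \<times> 'h \<Rightarrow> 'h \<times> 'h" where
  "energy_map R U = (R (fst U), snd U)"

lemma inner_energy_map: "energy_map R U \<bullet> energy_map R V = energy_inner R U V"
  by (simp add: energy_map_def energy_inner_def)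

lemma norm_energy_map: "norm (energy_map R U) = energy_norm R U"
  by (simp add: norm_eq_sqrt_inner inner_energy_map energy_norm_def)

text \<open>The integral is the Henstock--Kurzweil integral of the distribution, because its Bochner
  integral is restricted to second countable range types; the two agree on the integrands of the
  variation-of-constants formula below.\<close>

definition energy_has_integral ::
    "'h::real_inner set \<Rightarrow> ('h \<Rightarrow> 'h) \<Rightarrow> (real \<Rightarrow> 'h \<times> 'h) \<Rightarrow> 'h \<times> 'h \<Rightarrow> real set \<Rightarrow> bool" where
  "energy_has_integral DR R f I T \<longleftrightarrow> (\<forall>s\<in>T. f s \<in> energy_space DR) \<and> I \<in> energy_space DR \<and>
     ((\<lambda>s. energy_map R (f s)) has_integral energy_map R I) T"

definition C0_semigroup_energy ::
    "'h::real_inner set \<Rightarrow> ('h \<Rightarrow> 'h) \<Rightarrow> (real \<Rightarrow> 'h \<times> 'h \<Rightarrow> 'h \<times> 'h) \<Rightarrow> bool" where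
  "C0_semigroup_energy DR R S \<longleftrightarrow>
     (\<forall>t\<ge>0. S t \<in> energy_space DR \<rightarrow> energy_space DR \<and> linear_map_on (energy_space DR) (S t) \<and>
        (\<exists>K. \<forall>U\<in>energy_space DR. energy_norm R (S t U) \<le> K * energy_norm R U)) \<and>
     (\<forall>U\<in>energy_space DR. S 0 U = U) \<and>
     (\<forall>s\<ge>0. \<forall>t\<ge>0. \<forall>U\<in>energy_space DR. S (s + t) U = S s (S t U)) \<and>
     (\<forall>U\<in>energy_space DR. ((\<lambda>t. energy_map R (S t U)) \<longlongrightarrow> energy_map R U) (at_right 0))"

definition generates_energy ::
    "'h::real_inner set \<Rightarrow> ('h \<Rightarrow> 'h) \<Rightarrow> ('h \<times> 'h) set \<Rightarrow> ('h \<times> 'h \<Rightarrow> 'h \<times> 'h) \<Rightarrow>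
     (real \<Rightarrow> 'h \<times> 'h \<Rightarrow> 'h \<times> 'h) \<Rightarrow> bool" where
  "generates_energy DR R D G S \<longleftrightarrow> C0_semigroup_energy DR R S \<and> D \<subseteq> energy_space DR \<and>
     (\<forall>U\<in>energy_space DR. \<forall>V\<in>energy_space DR.
        ((\<lambda>t. energy_map R ((1 / t) *\<^sub>R (S t U - U))) \<longlongrightarrow> energy_map R V) (at_right 0)
          \<longleftrightarrow> U \<in> D \<and> V = G U)"

definition wave_op ::
    "('h::real_inner \<Rightarrow> 'h) \<Rightarrow> ('w::real_inner \<Rightarrow> 'h) \<Rightarrow> 'h \<times> 'h \<Rightarrow> 'h \<times> 'h" where
  "wave_op A C U = (snd U, - A (fst U) - C (adjoint C (snd U)))"

definition delay_op :: "('h::real_inner \<Rightarrow> 'h) \<Rightarrow> 'h \<times> 'h \<Rightarrow> 'h \<times> 'h" where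
  "delay_op B U = (0, - B (adjoint B (snd U)))"

text \<open>Finite-energy (weak) solutions of \<open>w\<^sub>t\<^sub>t + A w + C C\<^sup>* w\<^sub>t = 0\<close> on \<open>[0, \<infinity>)\<close>, with \<open>v = w\<^sub>t\<close>: the
  initial data \<open>(w 0, v 0)\<close> are arbitrary in the energy space.\<close>

definition damped_wave_solution ::
    "'h::real_inner set \<Rightarrow> ('h \<Rightarrow> 'h) \<Rightarrow> ('w::real_inner \<Rightarrow> 'h) \<Rightarrow> (real \<Rightarrow> 'h) \<Rightarrow> (real \<Rightarrow> 'h) \<Rightarrow> bool" where
  "damped_wave_solution DR R C w v \<longleftrightarrow>
     (\<forall>t\<ge>0. w t \<in> DR) \<and>
     continuous_on {0..} (\<lambda>t. energy_map R (w t, v t)) \<and>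
     (\<forall>t\<ge>0. (w has_vector_derivative v t) (at t within {0..})) \<and>
     (\<forall>\<phi>\<in>DR. \<forall>t\<ge>0. ((\<lambda>s. v s \<bullet> \<phi>) has_real_derivative
        - (R (w t) \<bullet> R \<phi>) - C (adjoint C (v t)) \<bullet> \<phi>) (at t within {0..}))"

definition gateaux_deriv :: "('h::real_vector \<Rightarrow> real) \<Rightarrow> 'h \<Rightarrow> 'h \<Rightarrow> real" where
  "gateaux_deriv \<psi> u v = Lim (at 0) (\<lambda>t. (\<psi> (u + t *\<^sub>R v) - \<psi> u) / t)"

definition gateaux_differentiable_on :: "'h::real_vector set \<Rightarrow> ('h \<Rightarrow> real) \<Rightarrow> bool" where
  "gateaux_differentiable_on V \<psi> \<longleftrightarrow> (\<forall>u\<in>V. linear_map_on V (gateaux_deriv \<psi> u) \<and>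
     (\<forall>v\<in>V. ((\<lambda>t. (\<psi> (u + t *\<^sub>R v) - \<psi> u) / t) \<longlongrightarrow> gateaux_deriv \<psi> u v) (at 0)))"

text \<open>Riesz representative in \<open>H\<close> of the derivative on \<open>V\<close>. It exists and is unique when \<open>V\<close> is
  dense and the derivative is linear and bounded on \<open>V\<close> with respect to the norm of \<open>H\<close>.\<close>

definition gradient_on :: "'h::real_inner set \<Rightarrow> ('h \<Rightarrow> real) \<Rightarrow> 'h \<Rightarrow> 'h" where
  "gradient_on V \<psi> u = (THE g. \<forall>v\<in>V. g \<bullet> v = gateaux_deriv \<psi> u v)"

definition delay_nonlinearity ::
    "'h::real_inner set \<Rightarrow> ('h \<Rightarrow> real) \<Rightarrow> ('h \<Rightarrow> real) \<Rightarrow> 'h \<times> 'h \<Rightarrow> 'h \<times> 'h \<Rightarrow> 'h \<times> 'h" where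
  "delay_nonlinearity V \<psi>1 \<psi>2 U U' = (0, gradient_on V \<psi>1 (fst U) + gradient_on V \<psi>2 (fst U'))"

text \<open>Global mild solutions; only the values of \<open>U\<close> on \<open>[-\<tau>, \<infinity>)\<close> are constrained.\<close>

definition delay_mild_solution ::
    "'h::real_inner set \<Rightarrow> ('h \<Rightarrow> 'h) \<Rightarrow> ('h \<Rightarrow> 'h) \<Rightarrow> ('h \<Rightarrow> real) \<Rightarrow> ('h \<Rightarrow> real) \<Rightarrow>
     (real \<Rightarrow> 'h \<times> 'h \<Rightarrow> 'h \<times> 'h) \<Rightarrow> (real \<Rightarrow> real) \<Rightarrow> real \<Rightarrow>
     (real \<Rightarrow> 'h \<times> 'h) \<Rightarrow> (real \<Rightarrow> 'h \<times> 'h) \<Rightarrow> bool" where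
  "delay_mild_solution DR R B \<psi>1 \<psi>2 S \<alpha> \<tau> \<Phi> U \<longleftrightarrow>
     (\<forall>t\<ge>-\<tau>. U t \<in> energy_space DR) \<and>
     continuous_on {-\<tau>..} (\<lambda>t. energy_map R (U t)) \<and>
     (\<forall>s\<in>{-\<tau>..0}. U s = \<Phi> s) \<and>
     (\<forall>t\<ge>0. energy_has_integral DR R
        (\<lambda>s. S (t - s) (\<alpha> s *\<^sub>R delay_op B (U (s - \<tau>)) + delay_nonlinearity DR \<psi>1 \<psi>2 (U s) (U (s - \<tau>))))
        (U t - S t (U 0)) {0..t})"

end

theory Submission
  imports Defs
begin

text \<open>
  Measured with the weight \<open>exp (\<omega> t)\<close>, which absorbs the decay of the semigroup, the Duhamel
  integrand of the delay problem is Lipschitz at time \<open>s\<close> with constant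
  \<open>a(s) = M b exp (\<omega> \<tau>) \<bar>\<alpha>(s)\<bar> + M L(r) (1 + exp (\<omega> \<tau>))\<close> as long as the curves stay in the ball of
  radius \<open>r\<close>. Let \<open>A(t)\<close> be the integral of \<open>a\<close> from 0 to \<open>t\<close>. Since
  \<open>a exp (l A)\<close> is the derivative of \<open>exp (l A) / l\<close>, bounds by multiples of
  \<open>exp (- \<omega> t + l A(t))\<close> reproduce themselves under the Duhamel map (\<open>duhamel_diff_le\<close>).

  For \<open>l = 1\<close> this is an invariant envelope \<open>K exp (- \<omega> t + A(t))\<close> for curves with small history,
  for \<open>l = 2\<close> a contraction by the factor \<open>1/2\<close> in a weighted supremum norm on the whole half-line.
  So Banach's fixed point theorem yields the global solution at once
  (\<open>global_solution_exists\<close>), without a continuation argument, and the contraction estimate on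
  compact intervals yields uniqueness among all continuous solutions (\<open>solution_unique\<close>).

  What keeps the envelope inside the ball of radius \<open>r = C\<^sub>\<rho>\<close> is the balance of rates
  (\<open>growth_le\<close>): choosing \<open>r\<close> so small that \<open>M L(r) (1 + exp (\<omega> \<tau>)) \<le> \<omega> - \<omega>'\<close>, one gets
  \<open>A(t) \<le> G + \<omega> t\<close> with a constant \<open>G\<close>, and \<open>K = r exp (- G)\<close> does it. The radius \<open>\<rho>\<close> is
  chosen so that a history of norm below \<open>\<rho>\<close> starts under this envelope.

  The abstract part lives on a closed subspace of a Banach space. The energy space becomes one
  through \<open>(u, v) \<mapsto> (\<surd>A u, v)\<close>, which is injective because \<open>A\<close> is positive. As \<open>H\<close> may be
  non-separable, integrals are Henstock--Kurzweil integrals; that an integrable scalar times a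
  continuous curve has one is \<open>integrable_L1_scaleR_continuous\<close>. Riesz representation supplies the
  adjoint \<open>B\<^sup>*\<close>.
\<close>

section \<open>Adjoints of bounded operators on Hilbert spaces\<close>

text \<open>The direct method: the parallelogram law makes every minimising sequence of
  \<open>x \<bullet> x - 2 * f x\<close> a Cauchy sequence, and the vanishing of the first variation at its limit
  is the representation. The adjoint of a bounded operator is thereby more than a choice from an
  empty set, so that \<open>B B\<^sup>*\<close> is a bounded operator with a meaningful operator norm.\<close>

lemma riesz_representation:
  fixes f :: "'h::{real_inner,complete_space} \<Rightarrow> real"
  assumes "bounded_linear f"
  shows "\<exists>g. \<forall>x. f x = x \<bullet> g"
proof -
  interpret f: bounded_linear f by fact
  define J where "J x = x \<bullet> x - 2 * f x" for x
  obtain K where K: "K > 0" "\<And>x. norm (f x) \<le> norm x * K"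
    using f.pos_bounded by blast
  have lower: "- K\<^sup>2 \<le> J x" for x
  proof -
    have "f x \<le> norm x * K"
      using K(2)[of x] by simp
    moreover have "0 \<le> (norm x - K)\<^sup>2"
      by simp
    ultimately show ?thesis
      by (simp add: J_def power2_eq_square algebra_simps flip: power2_norm_eq_inner)
  qed
  define m where "m = Inf (range J)"
  have bdd: "bdd_below (range J)"
    using lower by (intro bdd_belowI[of _ "- K\<^sup>2"]) auto
  have m_le: "m \<le> J x" for x
    unfolding m_def by (intro cInf_lower bdd) simp
  have "\<exists>x. J x < m + 1 / real (Suc n)" for n
  proof -
    have "Inf (range J) < m + 1 / real (Suc n)"
      unfolding m_def by simp
    then show ?thesis
      using cInf_lessD[of "range J"] by auto
  qed
  then obtain u where u: "\<And>n. J (u n) < m + 1 / real (Suc n)"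
    by metis
  have parallelogram: "(norm (x - y))\<^sup>2 = 2 * (J x + J y - 2 * J ((1/2) *\<^sub>R (x + y)))" for x y
    by (simp add: J_def f.scaleR f.add power2_norm_eq_inner inner_diff inner_add inner_commute algebra_simps)
  have "Cauchy u"
  proof (rule metric_CauchyI)
    fix e :: real assume e: "e > 0"
    obtain N where N: "4 / e\<^sup>2 < real (Suc N)"
      using reals_Archimedean2[of "4 / e\<^sup>2"] by (meson less_trans of_nat_less_iff lessI)
    have "dist (u i) (u j) < e" if "i \<ge> N" "j \<ge> N" for i j
    proof -
      have "1 / real (Suc k) \<le> 1 / real (Suc N)" if "k \<ge> N" for k
        using that by (simp add: frac_le)
      then have "J (u i) < m + 1 / real (Suc N)" "J (u j) < m + 1 / real (Suc N)"
        using u[of i] u[of j] that by (meson add_left_mono less_le_trans)+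
      moreover have "J p + J q - 2 * m' < 2 * r" if "J p < m + r" "J q < m + r" "m \<le> m'" for p q m' r
        using that by linarith
      ultimately have "(norm (u i - u j))\<^sup>2 < 4 * (1 / real (Suc N))"
        using m_le[of "(1/2) *\<^sub>R (u i + u j)"] unfolding parallelogram by (auto simp del: of_nat_Suc)
      also have "\<dots> < e\<^sup>2"
        using N e by (simp add: field_simps)
      finally show ?thesis
        using e by (simp add: dist_norm power_less_imp_less_base)
    qed
    then show "\<exists>N. \<forall>i\<ge>N. \<forall>j\<ge>N. dist (u i) (u j) < e"
      by blast
  qed
  then obtain g where g: "u \<longlonglongrightarrow> g"
    using Cauchy_convergent convergent_def by blast
  have "(\<lambda>n. J (u n)) \<longlonglongrightarrow> J g"
    unfolding J_def by (intro tendsto_intros g f.tendsto)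
  moreover have "(\<lambda>n. m + 1 / real (Suc n)) \<longlonglongrightarrow> m + 0"
    by (intro tendsto_intros LIMSEQ_Suc lim_1_over_n)
  ultimately have "J g \<le> m"
    using u LIMSEQ_le[of "\<lambda>n. J (u n)" "J g" "\<lambda>n. m + 1 / real (Suc n)" "m + 0"]
    by (auto intro: less_imp_le)
  then have g_min: "J g \<le> J y" for y
    using m_le order_trans by blast
  have "f v = v \<bullet> g" for v
  proof -
    define d where "d = v \<bullet> g - f v"
    define q where "q = v \<bullet> v"
    have q: "q \<ge> 0"
      by (simp add: q_def)
    have var: "0 \<le> 2 * t * d + t\<^sup>2 * q" for t
      using g_min[of "g + t *\<^sub>R v"]
      by (simp add: J_def d_def q_def f.add f.scaleR inner_add inner_commute power2_eq_square algebra_simps)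
    \<comment> \<open>The minimiser of the quadratic in \<open>t\<close> up to the shift by 1, which avoids division by
      zero when \<open>v = 0\<close>.\<close>
    obtain t where "- d = t * (q + 1)"
      using q by (metis add_nonneg_pos divide_eq_eq less_numeral_extra(1,3))
    then have d: "d = - (t * (q + 1))"
      by simp
    have "0 \<le> - (t\<^sup>2 * (q + 2))"
      using var[of t] by (simp add: d power2_eq_square algebra_simps)
    then have "t = 0"
      using q by (simp add: mult_le_0_iff)
    then have "d = 0"
      by (simp add: d)
    then show ?thesis
      by (simp add: d_def)
  qed
  then show ?thesis
    by blast
qed

lemma adjoint_inner:
  fixes f :: "'a::{real_inner,complete_space} \<Rightarrow> 'b::real_inner"
  assumes "bounded_linear f"
  shows "f x \<bullet> y = x \<bullet> adjoint f y"
proof -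
  have "\<exists>g. \<forall>x. f x \<bullet> y = x \<bullet> g" for y
    by (rule riesz_representation)
      (rule bounded_linear_compose[OF bounded_linear_inner_left assms])
  then have "\<exists>f'. \<forall>x y. f x \<bullet> y = x \<bullet> f' y"
    by metis
  from someI_ex[OF this] show ?thesis
    unfolding adjoint_def by blast
qed

lemma bounded_linear_adjoint:
  fixes f :: "'a::{real_inner,complete_space} \<Rightarrow> 'b::real_inner"
  assumes "bounded_linear f"
  shows "bounded_linear (adjoint f)"
proof -
  note adj = adjoint_inner[OF assms, symmetric]
  obtain K where K: "K > 0" "\<And>x. norm (f x) \<le> norm x * K"
    using bounded_linear.pos_bounded[OF assms] by blast
  show ?thesis
  proof (rule bounded_linear_intro)
    show "adjoint f (x + y) = adjoint f x + adjoint f y" for x y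
      by (subst vector_eq_ldot[symmetric]) (simp add: adj inner_add_right)
    show "adjoint f (c *\<^sub>R x) = c *\<^sub>R adjoint f x" for c x
      by (subst vector_eq_ldot[symmetric]) (simp add: adj)
    show "norm (adjoint f y) \<le> norm y * K" for y
    proof -
      have "(norm (adjoint f y))\<^sup>2 = f (adjoint f y) \<bullet> y"
        by (simp only: power2_norm_eq_inner adjoint_inner[OF assms])
      also have "\<dots> \<le> norm (f (adjoint f y)) * norm y"
        by (rule norm_cauchy_schwarz)
      also have "\<dots> \<le> norm (adjoint f y) * K * norm y"
        by (intro mult_right_mono K) simp
      finally have "norm (adjoint f y) * norm (adjoint f y) \<le> norm (adjoint f y) * (norm y * K)"
        by (simp add: power2_eq_square mult_ac)
      then show ?thesis
        using K(1) by (cases "adjoint f y = 0") auto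
    qed
  qed
qed

section \<open>Vector-valued integrals with integrable weights\<close>

text \<open>Uniform limits of integrable functions are integrable; a weight \<open>m\<close> that may be unbounded is
  admitted here. Riemann sums of \<open>f\<close> and of an approximant differ by at most \<open>e\<close> times a Riemann sum
  of \<open>m\<close>, and the latter stays bounded on fine divisions, so the Cauchy criterion passes from the
  approximants to \<open>f\<close>.\<close>

lemma integrable_if_weighted_approximable:
  fixes f :: "real \<Rightarrow> 'a::banach" and m :: "real \<Rightarrow> real"
  assumes m: "m integrable_on {a..b}" "\<And>x. x \<in> {a..b} \<Longrightarrow> 0 \<le> m x"
    and approx: "\<And>e. e > 0 \<Longrightarrow>
      \<exists>g. g integrable_on {a..b} \<and> (\<forall>x\<in>{a..b}. norm (f x - g x) \<le> e * m x)"
  shows "f integrable_on {a..b}"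
proof -
  define I where "I = integral {a..b} m"
  have I: "(m has_integral I) (cbox a b)"
    using m(1) by (simp add: I_def has_integral_integral)
  have I_pos: "I \<ge> 0"
    unfolding I_def by (intro integral_nonneg m)
  have "\<exists>\<gamma>. gauge \<gamma> \<and>
          (\<forall>D1 D2. D1 tagged_division_of (cbox a b) \<and> \<gamma> fine D1 \<and>
            D2 tagged_division_of (cbox a b) \<and> \<gamma> fine D2 \<longrightarrow>
            norm ((\<Sum>(x,K)\<in>D1. measure lborel K *\<^sub>R f x) - (\<Sum>(x,K)\<in>D2. measure lborel K *\<^sub>R f x)) < d)"
    if d: "d > 0" for d :: real
  proof -
    define e where "e = d / (4 * (I + 1))"
    have e: "e > 0" "e * (I + 1) = d / 4"
      using d I_pos by (simp_all add: e_def divide_simps)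
    obtain g where g: "g integrable_on cbox a b" "\<And>x. x \<in> cbox a b \<Longrightarrow> norm (f x - g x) \<le> e * m x"
      using approx[OF e(1)] by auto
    obtain \<gamma>1 where \<gamma>1: "gauge \<gamma>1 \<and> (\<forall>D. D tagged_division_of (cbox a b) \<and> \<gamma>1 fine D \<longrightarrow>
        norm ((\<Sum>(x,K)\<in>D. measure lborel K *\<^sub>R m x) - I) < 1)"
      using I[unfolded has_integral, THEN spec, THEN mp, OF zero_less_one] by (elim exE)
    have "d / 4 > 0"
      using d by simp
    with g(1) obtain \<gamma>2 where \<gamma>2: "gauge \<gamma>2"
      "\<And>D1 D2. D1 tagged_division_of (cbox a b) \<Longrightarrow> \<gamma>2 fine D1 \<Longrightarrow>
            D2 tagged_division_of (cbox a b) \<Longrightarrow> \<gamma>2 fine D2 \<Longrightarrow>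
            norm ((\<Sum>(x,K)\<in>D1. measure lborel K *\<^sub>R g x) - (\<Sum>(x,K)\<in>D2. measure lborel K *\<^sub>R g x)) < d / 4"
      unfolding integrable_Cauchy by metis
    have close: "norm ((\<Sum>(x,K)\<in>D. measure lborel K *\<^sub>R f x) - (\<Sum>(x,K)\<in>D. measure lborel K *\<^sub>R g x)) \<le> d / 4"
      if D: "D tagged_division_of (cbox a b)" and fine: "\<gamma>1 fine D" for D
    proof -
      have "norm ((\<Sum>(x,K)\<in>D. measure lborel K *\<^sub>R f x) - (\<Sum>(x,K)\<in>D. measure lborel K *\<^sub>R g x))
          = norm (\<Sum>(x,K)\<in>D. measure lborel K *\<^sub>R (f x - g x))"
        by (simp add: sum_subtractf[symmetric] case_prod_unfold scaleR_diff_right)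
      also have "\<dots> \<le> (\<Sum>(x,K)\<in>D. e * (measure lborel K *\<^sub>R m x))"
      proof (rule sum_norm_le, clarify)
        fix x K assume "(x, K) \<in> D"
        then have "x \<in> cbox a b"
          using tagged_division_ofD(2,3)[OF D] by blast
        from g(2)[OF this] show "norm (measure lborel K *\<^sub>R (f x - g x)) \<le> e * (measure lborel K *\<^sub>R m x)"
          by (simp add: mult_left_mono mult.left_commute[of e])
      qed
      also have "\<dots> = e * (\<Sum>(x,K)\<in>D. measure lborel K *\<^sub>R m x)"
        by (simp add: sum_distrib_left case_prod_unfold)
      also have "\<dots> \<le> e * (I + 1)"
        using \<gamma>1 D fine e(1) by (intro mult_left_mono) auto
      finally show ?thesis
        using e by simp
    qed
    show ?thesis
    proof (intro exI conjI allI impI)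
      show "gauge (\<lambda>x. \<gamma>1 x \<inter> \<gamma>2 x)"
        using \<gamma>1 \<gamma>2(1) by (blast intro: gauge_Int)
      fix D1 D2
      assume "D1 tagged_division_of (cbox a b) \<and> (\<lambda>x. \<gamma>1 x \<inter> \<gamma>2 x) fine D1 \<and>
            D2 tagged_division_of (cbox a b) \<and> (\<lambda>x. \<gamma>1 x \<inter> \<gamma>2 x) fine D2"
      then have D: "D1 tagged_division_of (cbox a b)" "D2 tagged_division_of (cbox a b)"
        "\<gamma>1 fine D1" "\<gamma>2 fine D1" "\<gamma>1 fine D2" "\<gamma>2 fine D2"
        by (auto simp: fine_Int)
      let ?S = "\<lambda>h D. \<Sum>(x,K)\<in>D. measure lborel K *\<^sub>R h x"
      have "norm (p - q) \<le> norm (p - p') + norm (p' - q') + norm (q - q')" for p q p' q' :: 'a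
        using dist_triangle[of p q p'] dist_triangle[of p' q q'] by (simp add: dist_norm norm_minus_commute)
      note this[of "?S f D1" "?S f D2" "?S g D1" "?S g D2"]
      then show "norm (?S f D1 - ?S f D2) < d"
        using close[OF D(1,3)] close[OF D(2,5)] \<gamma>2(2)[OF D(1,4,2,6)] d by linarith
    qed
  qed
  then have "f integrable_on cbox a b"
    unfolding integrable_Cauchy by blast
  then show ?thesis
    by simp
qed

text \<open>The approximants freeze \<open>p\<close> on short intervals, where the integrand becomes a scalar integrable
  function times a fixed vector. Bisection replaces an explicit partition.\<close>

lemma integrable_L1_scaleR_continuous:
  fixes p :: "real \<Rightarrow> 'a::banach" and \<beta> :: "real \<Rightarrow> real"
  assumes beta: "\<beta> absolutely_integrable_on {a..b}" and p: "continuous_on {a..b} p"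
  shows "(\<lambda>s. \<beta> s *\<^sub>R p s) integrable_on {a..b}"
proof (cases "a \<le> b")
  case ab: True
  have beta_int: "\<beta> integrable_on {a..b}" "(\<lambda>s. \<bar>\<beta> s\<bar>) integrable_on {a..b}"
    using beta by (auto simp: absolutely_integrable_on_def)
  show ?thesis
  proof (rule integrable_if_weighted_approximable[OF beta_int(2)])
    fix e :: real assume e: "e > 0"
    define P where "P u v \<longleftrightarrow> (a \<le> u \<and> v \<le> b \<longrightarrow> (\<exists>g. g integrable_on {u..v} \<and>
        (\<forall>x\<in>{u..v}. norm (\<beta> x *\<^sub>R p x - g x) \<le> e * \<bar>\<beta> x\<bar>)))" for u v
    have "P a b"
      using ab
    proof (induction rule: Bolzano)
      case (trans u v w)
      show ?case
        unfolding P_def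
      proof
        assume uw: "a \<le> u \<and> w \<le> b"
        obtain g1 where g1: "g1 integrable_on {u..v}"
          "\<And>x. x\<in>{u..v} \<Longrightarrow> norm (\<beta> x *\<^sub>R p x - g1 x) \<le> e * \<bar>\<beta> x\<bar>"
          using trans uw unfolding P_def by force
        obtain g2 where g2: "g2 integrable_on {v..w}"
          "\<And>x. x\<in>{v..w} \<Longrightarrow> norm (\<beta> x *\<^sub>R p x - g2 x) \<le> e * \<bar>\<beta> x\<bar>"
          using trans uw unfolding P_def by force
        let ?g = "\<lambda>x. if x \<le> v then g1 x else g2 x"
        have "?g integrable_on {u..v}"
          using g1(1) by (rule integrable_eq) auto
        moreover have "?g integrable_on {v..w}"
          using g2(1) by (rule integrable_spike[where S="{v}"]) auto
        ultimately have "?g integrable_on {u..w}"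
          using trans by (intro Henstock_Kurzweil_Integration.integrable_combine[of u v w])
        moreover have "\<forall>x\<in>{u..w}. norm (\<beta> x *\<^sub>R p x - ?g x) \<le> e * \<bar>\<beta> x\<bar>"
          using g1(2) g2(2) by auto
        ultimately show "\<exists>g. g integrable_on {u..w} \<and>
            (\<forall>x\<in>{u..w}. norm (\<beta> x *\<^sub>R p x - g x) \<le> e * \<bar>\<beta> x\<bar>)"
          by blast
      qed
    next
      case (local x)
      then obtain d where d: "d > 0"
        "\<And>y. y \<in> {a..b} \<Longrightarrow> dist y x < d \<Longrightarrow> dist (p y) (p x) < e"
        using p e unfolding continuous_on_iff by (metis atLeastAtMost_iff)
      show ?case
        unfolding P_def
      proof (intro exI[of _ d] conjI allI impI)
        fix u v assume uv: "u \<le> x \<and> x \<le> v \<and> v - u < d" and "a \<le> u \<and> v \<le> b"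
        then have sub: "{u..v} \<subseteq> {a..b}"
          by auto
        show "\<exists>g. g integrable_on {u..v} \<and>
            (\<forall>y\<in>{u..v}. norm (\<beta> y *\<^sub>R p y - g y) \<le> e * \<bar>\<beta> y\<bar>)"
        proof (intro exI[of _ "\<lambda>y. \<beta> y *\<^sub>R p x"] conjI ballI)
          have "\<beta> integrable_on {u..v}"
            using beta_int(1) sub by (rule integrable_on_subinterval)
          then show "(\<lambda>y. \<beta> y *\<^sub>R p x) integrable_on {u..v}"
            by (rule integrable_on_scaleR_left)
          fix y assume "y \<in> {u..v}"
          then have "dist (p y) (p x) < e"
            using uv sub by (intro d(2)) (auto simp: dist_real_def)
          then show "norm (\<beta> y *\<^sub>R p y - \<beta> y *\<^sub>R p x) \<le> e * \<bar>\<beta> y\<bar>"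
            by (simp add: dist_norm mult.commute[of e] mult_left_mono flip: scaleR_diff_right)
        qed
      qed (fact d)
    qed
    then show "\<exists>g. g integrable_on {a..b} \<and>
        (\<forall>x\<in>{a..b}. norm (\<beta> x *\<^sub>R p x - g x) \<le> e * \<bar>\<beta> x\<bar>)"
      by (simp add: P_def)
  qed simp
qed (use integrable_on_empty in auto)

lemma has_integral_in_closed_subspace:
  fixes f :: "real \<Rightarrow> 'a::banach"
  assumes X: "closed X" "subspace X" and f: "\<And>x. x \<in> {a..b} \<Longrightarrow> f x \<in> X"
    and I: "(f has_integral I) {a..b}"
  shows "I \<in> X"
proof -
  have "\<exists>y\<in>X. dist y I < e" if "e > 0" for e
  proof -
    have "(f has_integral I) (cbox a b)"
      using I by simp
    from this[unfolded has_integral, THEN spec, THEN mp, OF that]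
    obtain \<gamma> where \<gamma>: "gauge \<gamma> \<and> (\<forall>D. D tagged_division_of (cbox a b) \<and> \<gamma> fine D \<longrightarrow>
        norm ((\<Sum>(x,K)\<in>D. measure lborel K *\<^sub>R f x) - I) < e)"
      by (elim exE)
    obtain D where D: "D tagged_division_of (cbox a b)" "\<gamma> fine D"
      using fine_division_exists \<gamma> by blast
    have "(\<Sum>(x,K)\<in>D. measure lborel K *\<^sub>R f x) \<in> X"
    proof (intro subspace_sum[OF X(2)], clarify)
      fix x K assume "(x, K) \<in> D"
      then have "x \<in> {a..b}"
        using tagged_division_ofD(2,3)[OF D(1)] by fastforce
      then show "measure lborel K *\<^sub>R f x \<in> X"
        by (intro subspace_scale[OF X(2)] f)
    qed
    then show ?thesis
      using \<gamma> D by (intro bexI[of _ "\<Sum>(x,K)\<in>D. measure lborel K *\<^sub>R f x"]) (simp_all add: dist_norm)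
  qed
  then show ?thesis
    using X(1) closed_approachable by blast
qed

text \<open>The two sides are in fact equal, by the chain rule for absolutely continuous functions; the
  inequality alone has an elementary proof. On an interval so short that the exponent varies by at
  most \<open>e\<close>, bounding the exponential by its value at the right end point loses only a factor
  \<open>exp e\<close>. These local bounds add up, and \<open>e\<close> tends to 0.\<close>

lemma integral_L1_times_exp_primitive_le:
  fixes a :: "real \<Rightarrow> real"
  assumes a: "a absolutely_integrable_on {0..t}" "\<And>s. s \<in> {0..t} \<Longrightarrow> 0 \<le> a s"
    and t: "t \<ge> 0" and l: "l > 0"
  shows "integral {0..t} (\<lambda>s. a s * exp (l * integral {0..s} a)) \<le> (exp (l * integral {0..t} a) - 1) / l"
proof -
  define A where "A s = integral {0..s} a" for s
  define h where "h s = exp (l * A s)" for s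
  have a_int: "a integrable_on {u..v}" if "0 \<le> u" "v \<le> t" for u v
    using set_lebesgue_integral_eq_integral(1)[OF a(1)]
    by (rule integrable_on_subinterval) (use that in auto)
  have A_diff: "A v - A u = integral {u..v} a" if "0 \<le> u" "u \<le> v" "v \<le> t" for u v
    using Henstock_Kurzweil_Integration.integral_combine[of 0 u v a] a_int[of 0 v] that by (simp add: A_def)
  have A_mono: "A u \<le> A v" if "0 \<le> u" "u \<le> v" "v \<le> t" for u v
  proof -
    have "0 \<le> integral {u..v} a"
      by (rule integral_nonneg[OF a_int]) (use a(2) that in auto)
    then show ?thesis
      using A_diff[OF that] by linarith
  qed
  have A_cont: "continuous_on {0..t} A"
    unfolding A_def by (rule indefinite_integral_continuous_1) (use a_int[of 0 t] in simp)
  have h_cont: "continuous_on {0..t} h"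
    unfolding h_def by (intro continuous_intros A_cont)
  have ah_int: "(\<lambda>s. a s * h s) integrable_on {0..t}"
    using integrable_L1_scaleR_continuous[OF a(1) h_cont] by simp
  have "integral {0..t} (\<lambda>s. a s * h s) * l \<le> exp e * (h t - 1)" if e: "e > 0" for e
  proof -
    define P where "P u v \<longleftrightarrow> (0 \<le> u \<and> u \<le> v \<and> v \<le> t \<longrightarrow>
        integral {u..v} (\<lambda>s. a s * h s) * l \<le> exp e * (h v - h u))" for u v
    have "P 0 t"
      using t
    proof (induction rule: Bolzano)
      case (trans u v w)
      show ?case
        unfolding P_def
      proof
        assume uw: "0 \<le> u \<and> u \<le> w \<and> w \<le> t"
        have "integral {u..w} (\<lambda>s. a s * h s)
            = integral {u..v} (\<lambda>s. a s * h s) + integral {v..w} (\<lambda>s. a s * h s)"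
          using trans uw
          by (intro Henstock_Kurzweil_Integration.integral_combine[symmetric] integrable_on_subinterval[OF ah_int]) auto
        with trans uw show "integral {u..w} (\<lambda>s. a s * h s) * l \<le> exp e * (h w - h u)"
          by (simp add: P_def algebra_simps)
      qed
    next
      case (local x)
      have "e / (2*l) > 0" using e l by simp
      with local A_cont obtain d where d: "d > 0"
        "\<And>y. y \<in> {0..t} \<Longrightarrow> dist y x < d \<Longrightarrow> dist (A y) (A x) < e / (2*l)"
        unfolding continuous_on_iff by (metis atLeastAtMost_iff)
      show ?case
        unfolding P_def
      proof (intro exI[of _ d] conjI allI impI)
        fix u v assume uv: "u \<le> x \<and> x \<le> v \<and> v - u < d" and uv': "0 \<le> u \<and> u \<le> v \<and> v \<le> t"
        have "dist (A y) (A x) < e / (2*l)" if "y \<in> {u, v}" for y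
          using that uv uv' by (intro d(2)) (auto simp: dist_real_def)
        then have "dist (A u) (A x) < e / (2*l)" "dist (A v) (A x) < e / (2*l)"
          by blast+
        then have "A v - A u < e / (2*l) + e / (2*l)"
          unfolding dist_real_def by linarith
        then have small: "l * (A v - A u) \<le> e"
          using l by (simp add: field_simps)
        have "integral {u..v} (\<lambda>s. a s * h s) \<le> integral {u..v} (\<lambda>s. h v * a s)"
        proof (rule integral_le)
          show "(\<lambda>s. a s * h s) integrable_on {u..v}"
            using ah_int by (rule integrable_on_subinterval) (use uv' in auto)
          show "(\<lambda>s. h v * a s) integrable_on {u..v}"
            using a_int[of u v] uv' by (intro integrable_on_mult_right) auto
          fix s assume "s \<in> {u..v}"
          then have "h s \<le> h v" "0 \<le> a s"
            using A_mono[of s v] a(2) uv' l by (auto simp: h_def)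
          then show "a s * h s \<le> h v * a s"
            by (simp add: mult.commute mult_left_mono)
        qed
        also have "\<dots> = h v * (A v - A u)"
          using A_diff uv' by simp
        finally have "integral {u..v} (\<lambda>s. a s * h s) * l \<le> h v * (l * (A v - A u))"
          using l by (simp add: mult_ac)
        also have "\<dots> = h u * exp (l * (A v - A u)) * (l * (A v - A u))"
          by (simp add: h_def algebra_simps flip: exp_add)
        also have "\<dots> \<le> h u * exp e * (l * (A v - A u))"
          using small A_mono uv' l by (intro mult_right_mono mult_left_mono) (auto simp: h_def)
        also have "\<dots> \<le> h u * exp e * (exp (l * (A v - A u)) - 1)"
        proof (intro mult_left_mono)
          show "l * (A v - A u) \<le> exp (l * (A v - A u)) - 1"
            using exp_ge_add_one_self[of "l * (A v - A u)"] by linarith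
        qed (simp add: h_def)
        also have "\<dots> = exp e * (h v - h u)"
          by (simp add: h_def algebra_simps flip: exp_add)
        finally show "integral {u..v} (\<lambda>s. a s * h s) * l \<le> exp e * (h v - h u)" .
      qed (fact d)
    qed
    then show ?thesis
      using t by (simp add: P_def h_def A_def)
  qed
  then have "\<forall>\<^sub>F e in at_right 0. integral {0..t} (\<lambda>s. a s * h s) * l \<le> exp e * (h t - 1)"
    by (simp add: eventually_at_filter)
  moreover have "((\<lambda>e. exp e * (h t - 1)) \<longlongrightarrow> exp 0 * (h t - 1)) (at_right 0)"
    by (intro tendsto_intros)
  ultimately have "integral {0..t} (\<lambda>s. a s * h s) * l \<le> exp 0 * (h t - 1)"
    by (intro tendsto_lowerbound) auto
  then show ?thesis
    using l by (simp add: pos_le_divide_eq h_def A_def)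
qed

section \<open>Convolution with an exponentially stable semigroup\<close>

text \<open>The semigroup acts on a closed subspace \<open>X\<close> of a Banach space: the isometric image of the energy
  space is of this kind, and vector-valued integrals are then taken in the ambient space.\<close>

locale stable_semigroup =
  fixes X :: "'a::banach set" and T :: "real \<Rightarrow> 'a \<Rightarrow> 'a" and M \<omega> :: real
  assumes closed_X: "closed X" and subspace_X: "subspace X"
    and T_in: "\<And>t x. t \<ge> 0 \<Longrightarrow> x \<in> X \<Longrightarrow> T t x \<in> X"
    and T_linear: "\<And>t. t \<ge> 0 \<Longrightarrow> linear_map_on X (T t)"
    and T_0: "\<And>x. x \<in> X \<Longrightarrow> T 0 x = x"
    and T_semigroup: "\<And>s t x. s \<ge> 0 \<Longrightarrow> t \<ge> 0 \<Longrightarrow> x \<in> X \<Longrightarrow> T (s + t) x = T s (T t x)"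
    and T_tendsto: "\<And>x. x \<in> X \<Longrightarrow> ((\<lambda>t. T t x) \<longlongrightarrow> x) (at_right 0)"
    and T_decay: "\<And>t x. t \<ge> 0 \<Longrightarrow> x \<in> X \<Longrightarrow> norm (T t x) \<le> M * exp (- \<omega> * t) * norm x"
    and M_pos: "M > 0" and omega_pos: "\<omega> > 0"
begin

lemma T_add: "t \<ge> 0 \<Longrightarrow> x \<in> X \<Longrightarrow> y \<in> X \<Longrightarrow> T t (x + y) = T t x + T t y"
  using T_linear by (auto simp: linear_map_on_def)

lemma T_scale: "t \<ge> 0 \<Longrightarrow> x \<in> X \<Longrightarrow> T t (c *\<^sub>R x) = c *\<^sub>R T t x"
  using T_linear by (auto simp: linear_map_on_def)

lemma T_diff:
  assumes "t \<ge> 0" "x \<in> X" "y \<in> X"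
  shows "T t (x - y) = T t x - T t y"
  using T_add[of t x "- 1 *\<^sub>R y"] T_scale[of t y "- 1"] assms subspace_neg[OF subspace_X, of y] by simp

lemma T_bound:
  assumes "t \<ge> 0" "x \<in> X"
  shows "norm (T t x) \<le> M * norm x"
proof -
  have "M * exp (- \<omega> * t) * norm x \<le> M * 1 * norm x"
    using M_pos omega_pos assms by (intro mult_right_mono mult_left_mono) auto
  then show ?thesis
    using T_decay[OF assms] by simp
qed

text \<open>The semigroup law moves the comparison of two times to time 0, so strong continuity at 0 from the
  right controls the orbit everywhere, on both sides and uniformly in time.\<close>

lemma T_increment_le:
  assumes "t \<ge> 0" "t' \<ge> 0" "x \<in> X"
  shows "norm (T t x - T t' x) \<le> M * norm (T \<bar>t - t'\<bar> x - x)"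
proof -
  have *: "norm (T t x - T t' x) \<le> M * norm (T (t - t') x - x)" if "0 \<le> t'" "t' \<le> t" for t t'
  proof -
    have "T t x = T t' (T (t - t') x)"
      using T_semigroup[of t' "t - t'" x] that assms by simp
    then have "T t x - T t' x = T t' (T (t - t') x - x)"
      using T_diff[of t' "T (t - t') x" x] T_in[of "t - t'" x] that assms by simp
    then show ?thesis
      using T_bound[of t' "T (t - t') x - x"] subspace_diff[OF subspace_X] T_in[of "t - t'" x] that assms
      by simp
  qed
  show ?thesis
    using *[of t' t] *[of t t'] assms by (cases "t' \<le> t") (simp_all add: abs_if norm_minus_commute)
qed

lemma T_jointly_continuous: "continuous_on ({0..} \<times> X) (\<lambda>(t, x). T t x)"
  unfolding continuous_on_iff
proof (intro ballI allI impI)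
  fix y0 :: "real \<times> 'a" and e :: real
  assume "y0 \<in> {0..} \<times> X" and e: "e > 0"
  then obtain t0 x0 where y0: "y0 = (t0, x0)" and t0: "t0 \<in> {0..}" and x0: "x0 \<in> X"
    by blast
  define e' where "e' = e / (2 * M)"
  have e': "e' > 0" "M * e' = e / 2"
    using e M_pos by (simp_all add: e'_def)
  have "\<forall>\<^sub>F h in at_right 0. dist (T h x0) x0 < e'"
    using T_tendsto[OF x0] e'(1) by (rule tendstoD)
  then obtain d where d: "d > 0" "\<And>h. 0 < h \<Longrightarrow> h < d \<Longrightarrow> dist (T h x0) x0 < e'"
    unfolding eventually_at_right_field by auto
  have d': "norm (T h x0 - x0) < e'" if "0 \<le> h" "h < d" for h
    using d(2)[of h] that T_0[OF x0] e'(1) by (cases "h = 0") (auto simp: dist_norm)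
  have "dist (T t x) (T t0 x0) < e"
    if t: "t \<in> {0..}" and x: "x \<in> X" and close: "dist (t, x) (t0, x0) < min d e'" for t x
  proof -
    have "dist t t0 < d" "dist x x0 < e'"
      using close dist_fst_le[of "(t, x)" "(t0, x0)"] dist_snd_le[of "(t, x)" "(t0, x0)"] by auto
    then have close': "\<bar>t - t0\<bar> < d" "norm (x - x0) < e'"
      by (simp_all add: dist_norm)
    have "norm (T t x - T t x0) \<le> M * norm (x - x0)"
      using T_bound[of t "x - x0"] T_diff[of t x x0] subspace_diff[OF subspace_X x x0] t x x0 by simp
    also have "\<dots> < e / 2"
      using close'(2) M_pos e'(2) by (metis mult_strict_left_mono)
    finally have "norm (T t x - T t x0) < e / 2" .
    moreover have "norm (T t x0 - T t0 x0) \<le> M * norm (T \<bar>t - t0\<bar> x0 - x0)"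
      using T_increment_le t t0 x0 by simp
    moreover have "M * norm (T \<bar>t - t0\<bar> x0 - x0) < e / 2"
      using d'[OF _ close'(1)] M_pos e'(2) by (metis abs_ge_zero mult_strict_left_mono)
    ultimately show ?thesis
      using dist_triangle[of "T t x" "T t0 x0" "T t x0"] by (simp add: dist_norm)
  qed
  then show "\<exists>d>0. \<forall>y\<in>{0..} \<times> X. dist y y0 < d \<longrightarrow>
      dist (case y of (t, x) \<Rightarrow> T t x) (case y0 of (t, x) \<Rightarrow> T t x) < e"
    unfolding y0 using d(1) e'(1) by (intro exI[of _ "min d e'"]) auto
qed

lemma convolution_kernel_continuous:
  assumes p: "continuous_on J p" "p ` J \<subseteq> X"
  shows "continuous_on (UNIV \<times> J) (\<lambda>(t, s). T (max 0 (t - s)) (p s))"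
proof -
  have "continuous_on (UNIV \<times> J) (\<lambda>y. p (snd y))"
    by (rule continuous_on_compose2[OF p(1)]) (auto intro: continuous_intros)
  then have "continuous_on (UNIV \<times> J) (\<lambda>y. (max 0 (fst y - snd y), p (snd y)))"
    by (intro continuous_intros)
  from continuous_on_compose2[OF T_jointly_continuous this] show ?thesis
    using p(2) by (force simp: case_prod_unfold)
qed

text \<open>Existence and continuity of the Duhamel integral of an integrable scalar weight times a continuous
  curve. The kernel is extended by \<open>max 0 (t - s)\<close> beyond the triangle \<open>s \<le> t\<close>, which makes it
  continuous, hence uniformly continuous, on a square.\<close>

lemma convolution:
  fixes p :: "real \<Rightarrow> 'a" and \<beta> :: "real \<Rightarrow> real"
  assumes beta: "\<beta> absolutely_integrable_on {0..c}"
    and p: "continuous_on {0..c} p" "p ` {0..c} \<subseteq> X"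
  defines "v \<equiv> \<lambda>t. integral {0..t} (\<lambda>s. \<beta> s *\<^sub>R T (t - s) (p s))"
  shows convolution_integrable:
      "\<And>t. t \<in> {0..c} \<Longrightarrow> (\<lambda>s. \<beta> s *\<^sub>R T (t - s) (p s)) integrable_on {0..t}"
    and convolution_continuous: "continuous_on {0..c} v"
proof -
  define k where "k = (\<lambda>t s. T (max 0 (t - s)) (p s))"
  have "continuous_on (UNIV \<times> {0..c}) (\<lambda>(t, s). k t s)"
    unfolding k_def by (rule convolution_kernel_continuous[OF p])
  then have k_cont: "continuous_on ({0..c} \<times> {0..c}) (\<lambda>(t, s). k t s)"
    by (rule continuous_on_subset) auto
  have k_bounded: "\<exists>K>0. \<forall>t\<in>{0..c}. \<forall>s\<in>{0..c}. norm (k t s) \<le> K"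
  proof -
    have "compact ((\<lambda>(t, s). k t s) ` ({0..c} \<times> {0..c}))"
      by (intro compact_continuous_image k_cont compact_Times) auto
    then obtain K where "K > 0" "\<forall>y\<in>(\<lambda>(t, s). k t s) ` ({0..c} \<times> {0..c}). norm y \<le> K"
      using compact_imp_bounded bounded_pos by blast
    then show ?thesis
      by (intro exI[of _ K]) auto
  qed
  then obtain K where K: "K > 0" "\<And>t s. t \<in> {0..c} \<Longrightarrow> s \<in> {0..c} \<Longrightarrow> norm (k t s) \<le> K"
    by blast
  have kt: "continuous_on {0..c} (k t)" if "t \<in> {0..c}" for t
    by (rule continuous_on_compose2[OF k_cont, of "{0..c}" "\<lambda>s. (t, s)", simplified])
      (use that in \<open>auto intro!: continuous_intros\<close>)
  have bk_int: "(\<lambda>s. \<beta> s *\<^sub>R k t s) integrable_on {u..w}" if "t \<in> {0..c}" "0 \<le> u" "w \<le> c" for t u w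
    using integrable_L1_scaleR_continuous[OF beta kt[OF that(1)]]
    by (rule integrable_on_subinterval) (use that in auto)
  have eq: "\<beta> s *\<^sub>R k t s = \<beta> s *\<^sub>R T (t - s) (p s)" if "s \<in> {0..t}" for s t
    using that by (simp add: k_def)
  show "(\<lambda>s. \<beta> s *\<^sub>R T (t - s) (p s)) integrable_on {0..t}" if "t \<in> {0..c}" for t
    by (rule integrable_eq[OF bk_int[of t 0 t] eq]) (use that in auto)
  have v_eq: "v t = integral {0..t} (\<lambda>s. \<beta> s *\<^sub>R k t s)" for t
    unfolding v_def by (intro integral_cong) (simp add: eq)
  have abs_int: "(\<lambda>s. \<bar>\<beta> s\<bar>) integrable_on {u..w}" if "0 \<le> u" "w \<le> c" for u w
    using absolutely_integrable_on_def[THEN iffD1, OF beta, THEN conjunct2, unfolded real_norm_def]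
    by (rule integrable_on_subinterval) (use that in auto)
  define N where "N t = integral {0..t} (\<lambda>s. \<bar>\<beta> s\<bar>)" for t
  have N_cont: "continuous_on {0..c} N"
    unfolding N_def by (intro indefinite_integral_continuous_1 abs_int) auto
  have N_le: "0 \<le> N t" "N t \<le> N c" if "t \<in> {0..c}" for t
    unfolding N_def using that abs_int
    by (auto intro!: integral_nonneg integral_subset_le)
  \<comment> \<open>Moving the upper limit costs the mass of \<open>\<beta>\<close> on the gap, moving the parameter costs the
    oscillation of the kernel.\<close>
  have v_diff: "norm (v t - v t') \<le> e * N c + K * (N t - N t')"
    if t: "0 \<le> t'" "t' \<le> t" "t \<le> c" and e: "e \<ge> 0" "\<And>s. s \<in> {0..c} \<Longrightarrow> norm (k t s - k t' s) \<le> e"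
    for t t' e
  proof -
    have "v t = integral {0..t'} (\<lambda>s. \<beta> s *\<^sub>R k t s) + integral {t'..t} (\<lambda>s. \<beta> s *\<^sub>R k t s)"
      unfolding v_eq using t by (intro Henstock_Kurzweil_Integration.integral_combine[symmetric] bk_int) auto
    moreover have "integral {0..t'} (\<lambda>s. \<beta> s *\<^sub>R k t s) - v t'
        = integral {0..t'} (\<lambda>s. \<beta> s *\<^sub>R k t s - \<beta> s *\<^sub>R k t' s)"
      unfolding v_eq using t by (intro Henstock_Kurzweil_Integration.integral_diff[symmetric] bk_int) auto
    moreover have "norm (integral {0..t'} (\<lambda>s. \<beta> s *\<^sub>R k t s - \<beta> s *\<^sub>R k t' s))
        \<le> integral {0..t'} (\<lambda>s. e * \<bar>\<beta> s\<bar>)"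
    proof (rule integral_norm_bound_integral)
      show "(\<lambda>s. \<beta> s *\<^sub>R k t s - \<beta> s *\<^sub>R k t' s) integrable_on {0..t'}"
        using t by (intro integrable_diff bk_int) auto
      show "(\<lambda>s. e * \<bar>\<beta> s\<bar>) integrable_on {0..t'}"
        using t by (intro integrable_on_mult_right abs_int) auto
      show "norm (\<beta> s *\<^sub>R k t s - \<beta> s *\<^sub>R k t' s) \<le> e * \<bar>\<beta> s\<bar>" if "s \<in> {0..t'}" for s
        using e(2)[of s] that t by (simp add: mult.commute[of e] mult_left_mono flip: scaleR_diff_right)
    qed
    moreover have "integral {0..t'} (\<lambda>s. e * \<bar>\<beta> s\<bar>) \<le> e * N c"
      using N_le[of t'] t e(1) by (simp add: N_def[symmetric] mult_left_mono)
    moreover have "norm (integral {t'..t} (\<lambda>s. \<beta> s *\<^sub>R k t s)) \<le> integral {t'..t} (\<lambda>s. K * \<bar>\<beta> s\<bar>)"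
    proof (rule integral_norm_bound_integral)
      show "(\<lambda>s. \<beta> s *\<^sub>R k t s) integrable_on {t'..t}"
        using t by (intro bk_int) auto
      show "(\<lambda>s. K * \<bar>\<beta> s\<bar>) integrable_on {t'..t}"
        using t by (intro integrable_on_mult_right abs_int) auto
      show "norm (\<beta> s *\<^sub>R k t s) \<le> K * \<bar>\<beta> s\<bar>" if "s \<in> {t'..t}" for s
        using K(2)[of t s] that t by (simp add: mult.commute[of K] mult_left_mono)
    qed
    moreover have "integral {t'..t} (\<lambda>s. K * \<bar>\<beta> s\<bar>) = K * (N t - N t')"
      using Henstock_Kurzweil_Integration.integral_combine[of 0 t' t "\<lambda>s. \<bar>\<beta> s\<bar>"] abs_int[of 0 t] t
      by (simp add: N_def)
    ultimately show ?thesis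
      using norm_triangle_ineq[of "integral {0..t'} (\<lambda>s. \<beta> s *\<^sub>R k t s) - v t'"
          "integral {t'..t} (\<lambda>s. \<beta> s *\<^sub>R k t s)"]
      by (simp add: algebra_simps)
  qed
  show "continuous_on {0..c} v"
    unfolding continuous_on_iff
  proof (intro ballI allI impI)
    fix t0 e :: real assume t0: "t0 \<in> {0..c}" and e: "e > 0"
    have Nc: "N c \<ge> 0"
      using N_le(1)[of c] t0 by simp
    define e1 where "e1 = e / (2 * (N c + 1))"
    have e1: "e1 > 0" "e1 * (N c + 1) = e / 2"
      using e Nc by (simp_all add: e1_def divide_simps)
    have "uniformly_continuous_on ({0..c} \<times> {0..c}) (\<lambda>(t, s). k t s)"
      by (intro compact_uniformly_continuous k_cont compact_Times) auto
    then obtain d1 where d1: "d1 > 0" "\<And>y y'. y \<in> {0..c} \<times> {0..c} \<Longrightarrow> y' \<in> {0..c} \<times> {0..c} \<Longrightarrow>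
        dist y' y < d1 \<Longrightarrow> dist (case y' of (t, s) \<Rightarrow> k t s) (case y of (t, s) \<Rightarrow> k t s) < e1"
      using e1(1) unfolding uniformly_continuous_on_def by meson
    have "e / (2 * K) > 0"
      using e K(1) by simp
    then obtain d2 where d2: "d2 > 0" "\<And>t. t \<in> {0..c} \<Longrightarrow> dist t t0 < d2 \<Longrightarrow> dist (N t) (N t0) < e / (2 * K)"
      using N_cont t0 unfolding continuous_on_iff by meson
    have "dist (v t) (v t0) < e" if t: "t \<in> {0..c}" and close: "dist t t0 < min d1 d2" for t
    proof -
      have k_close: "norm (k t s - k t0 s) \<le> e1" if "s \<in> {0..c}" for s
        using d1(2)[of "(t0, s)" "(t, s)"] that t t0 close by (simp add: dist_Pair_Pair dist_norm)
      have "K * \<bar>N t - N t0\<bar> < K * (e / (2 * K))"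
        using d2(2)[OF t] close K(1) by (intro mult_strict_left_mono) (auto simp: dist_norm)
      then have N_close: "K * \<bar>N t - N t0\<bar> < e / 2"
        using K(1) by simp
      have "norm (v t - v t0) \<le> e1 * N c + K * \<bar>N t - N t0\<bar>"
      proof (cases "t0 \<le> t")
        case True
        have "K * (N t - N t0) \<le> K * \<bar>N t - N t0\<bar>"
          using K(1) by (intro mult_left_mono) auto
        then show ?thesis
          using v_diff[of t0 t e1] True t t0 k_close e1(1) by simp
      next
        case False
        have "K * (N t0 - N t) \<le> K * \<bar>N t - N t0\<bar>"
          using K(1) by (intro mult_left_mono) auto
        then show ?thesis
          using v_diff[of t t0 e1] False t t0 k_close e1(1) by (simp add: norm_minus_commute)
      qed
      moreover have "e1 * N c \<le> e / 2"
        using e1 by (simp add: algebra_simps)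
      ultimately show ?thesis
        using N_close by (simp add: dist_norm)
    qed
    then show "\<exists>d>0. \<forall>t\<in>{0..c}. dist t t0 < d \<longrightarrow> dist (v t) (v t0) < e"
      using d1(1) d2(1) by (intro exI[of _ "min d1 d2"]) auto
  qed
qed

end

section \<open>Global mild solutions of delayed semilinear equations\<close>

lemma continuous_on_UNIV_if_atMost:
  fixes f :: "real \<Rightarrow> 'a::metric_space"
  assumes "\<And>c. continuous_on {..c} f"
  shows "continuous_on UNIV f"
proof -
  have "isCont f t" for t
    using continuous_on_interior[OF assms[of "t + 1"], of t] by simp
  then show ?thesis
    by (simp add: continuous_at_imp_continuous_on)
qed

text \<open>The equation \<open>U' = G U + \<alpha>(t) D U(t - \<tau>) + F(U(t), U(t - \<tau>))\<close>, where \<open>G\<close> generates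
  \<open>T\<close>, for a nonlinearity that is Lipschitz with constant \<open>L r\<close> on the ball of radius \<open>r\<close>.\<close>

locale delayed_semilinear = stable_semigroup X T M \<omega>
  for X :: "'a::banach set" and T and M \<omega> :: real +
  fixes D :: "'a \<Rightarrow> 'a" and F :: "'a \<Rightarrow> 'a \<Rightarrow> 'a" and \<alpha> L :: "real \<Rightarrow> real" and \<tau> b :: real
  assumes D_in: "\<And>x. x \<in> X \<Longrightarrow> D x \<in> X"
    and D_linear: "linear_map_on X D"
    and D_bound: "\<And>x. x \<in> X \<Longrightarrow> norm (D x) \<le> b * norm x"
    and b_nonneg: "b \<ge> 0"
    and F_in: "\<And>x y. x \<in> X \<Longrightarrow> y \<in> X \<Longrightarrow> F x y \<in> X"
    and F_0: "F 0 0 = 0"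
    and F_lipschitz: "\<And>r x x' y y'. r > 0 \<Longrightarrow> {x, x', y, y'} \<subseteq> X \<inter> cball 0 r \<Longrightarrow>
          norm (F x x' - F y y') \<le> L r * (norm (x - y) + norm (x' - y'))"
    and L_pos: "\<And>r. r > 0 \<Longrightarrow> L r > 0"
    and alpha_L1: "\<And>c. \<alpha> absolutely_integrable_on {0..c}"
    and tau_pos: "\<tau> > 0"
begin

definition forcing :: "(real \<Rightarrow> 'a) \<Rightarrow> real \<Rightarrow> 'a" where
  "forcing U s = \<alpha> s *\<^sub>R D (U (s - \<tau>)) + F (U s) (U (s - \<tau>))"

definition duhamel :: "(real \<Rightarrow> 'a) \<Rightarrow> real \<Rightarrow> 'a" where
  "duhamel U t = integral {0..t} (\<lambda>s. T (t - s) (forcing U s))"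

text \<open>\<open>rate r s\<close> is a Lipschitz constant at time \<open>s\<close> of the Duhamel integrand, on curves in the ball of
  radius \<open>r\<close> and measured with the weight \<open>exp (\<omega> s)\<close> that absorbs the decay of the semigroup:
  reading a value at \<open>s - \<tau>\<close> instead of \<open>s\<close> costs the factor \<open>exp (\<omega> \<tau>)\<close>. Its primitive \<open>growth r\<close>
  is therefore the exponent that a Gronwall argument would produce.\<close>

definition rate :: "real \<Rightarrow> real \<Rightarrow> real" where
  "rate r s = M * b * exp (\<omega> * \<tau>) * \<bar>\<alpha> s\<bar> + M * L r * (1 + exp (\<omega> * \<tau>))"

definition growth :: "real \<Rightarrow> real \<Rightarrow> real" where
  "growth r t = integral {0..t} (rate r)"

definition solution :: "(real \<Rightarrow> 'a) \<Rightarrow> (real \<Rightarrow> 'a) \<Rightarrow> bool" where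
  "solution \<phi> U \<longleftrightarrow> (\<forall>t\<ge>-\<tau>. U t \<in> X) \<and> continuous_on {-\<tau>..} U \<and> (\<forall>s\<in>{-\<tau>..0}. U s = \<phi> s) \<and>
     (\<forall>t\<ge>0. ((\<lambda>s. T (t - s) (forcing U s)) has_integral (U t - T t (U 0))) {0..t})"

lemma zero_in_X: "0 \<in> X"
  by (rule subspace_0[OF subspace_X])

lemma D_diff:
  assumes "x \<in> X" "y \<in> X"
  shows "D (x - y) = D x - D y"
proof -
  have "- 1 *\<^sub>R y \<in> X"
    using assms subspace_X by (blast intro: subspace_scale)
  then have "D (x + - 1 *\<^sub>R y) = D x + D (- 1 *\<^sub>R y)" "D (- 1 *\<^sub>R y) = - 1 *\<^sub>R D y"
    using D_linear assms unfolding linear_map_on_def by blast+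
  then show ?thesis
    by simp
qed

lemma forcing_in:
  assumes "U s \<in> X" "U (s - \<tau>) \<in> X"
  shows "forcing U s \<in> X"
  unfolding forcing_def using assms
  by (intro subspace_add[OF subspace_X] subspace_scale[OF subspace_X] D_in F_in)

lemma D_history_continuous:
  assumes U: "continuous_on {-\<tau>..c} U" "U ` {-\<tau>..c} \<subseteq> X"
  shows "continuous_on {0..c} (\<lambda>s. D (U (s - \<tau>)))"
proof -
  have "continuous_on X D"
  proof (rule continuous_onI)
    fix x and e :: real assume x: "x \<in> X" and e: "e > 0"
    have "dist (D y) (D x) \<le> e" if "y \<in> X" "dist y x < e / (b + 1)" for y
    proof -
      have "norm (D y - D x) \<le> b * norm (y - x)"
        using D_bound[of "y - x"] D_diff that x subspace_diff[OF subspace_X] by simp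
      also have "\<dots> \<le> (b + 1) * norm (y - x)"
        by (intro mult_right_mono) auto
      also have "\<dots> \<le> e"
        using that(2) b_nonneg by (simp add: dist_norm field_simps)
      finally show ?thesis
        by (simp add: dist_norm)
    qed
    then show "\<exists>d>0. \<forall>y\<in>X. dist y x < d \<longrightarrow> dist (D y) (D x) \<le> e"
      using e b_nonneg by (intro exI[of _ "e / (b + 1)"]) auto
  qed
  moreover have "continuous_on {0..c} (\<lambda>s. U (s - \<tau>))"
    by (rule continuous_on_compose2[OF U(1)]) (use tau_pos in \<open>auto intro!: continuous_intros\<close>)
  ultimately show ?thesis
    by (rule continuous_on_compose2) (use U(2) tau_pos in \<open>auto simp: image_subset_iff\<close>)
qed

lemma F_history_continuous:
  assumes U: "continuous_on {-\<tau>..c} U" "U ` {-\<tau>..c} \<subseteq> X"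
  shows "continuous_on {0..c} (\<lambda>s. F (U s) (U (s - \<tau>)))"
proof -
  have "bounded (U ` {-\<tau>..c})"
    using U(1) by (intro compact_imp_bounded compact_continuous_image) auto
  then obtain r where r: "r > 0" "\<And>s. s \<in> {-\<tau>..c} \<Longrightarrow> norm (U s) \<le> r"
    unfolding bounded_pos by blast
  have shift: "continuous_on {0..c} (\<lambda>s. U (s - \<tau>))"
    by (rule continuous_on_compose2[OF U(1)]) (use tau_pos in \<open>auto intro!: continuous_intros\<close>)
  have noshift: "continuous_on {0..c} U"
    by (rule continuous_on_subset[OF U(1)]) (use tau_pos in auto)
  show ?thesis
    unfolding continuous_on_def
  proof
    fix s0 assume s0: "s0 \<in> {0..c}"
    let ?G = "\<lambda>s. F (U s) (U (s - \<tau>))"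
    have "((\<lambda>s. L r * (norm (U s - U s0) + norm (U (s - \<tau>) - U (s0 - \<tau>))))
        \<longlongrightarrow> L r * (norm (U s0 - U s0) + norm (U (s0 - \<tau>) - U (s0 - \<tau>)))) (at s0 within {0..c})"
      using shift noshift s0 unfolding continuous_on_def by (intro tendsto_intros) auto
    then have lim: "((\<lambda>s. L r * (norm (U s - U s0) + norm (U (s - \<tau>) - U (s0 - \<tau>))))
        \<longlongrightarrow> 0) (at s0 within {0..c})"
      by simp
    have "norm (?G s - ?G s0) \<le> L r * (norm (U s - U s0) + norm (U (s - \<tau>) - U (s0 - \<tau>)))"
      if "s \<in> {0..c}" for s
      by (rule F_lipschitz[OF r(1)]) (use that s0 r(2) U(2) tau_pos in \<open>auto simp: image_subset_iff\<close>)
    then have "\<forall>\<^sub>F s in at s0 within {0..c}.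
        norm (?G s - ?G s0) \<le> L r * (norm (U s - U s0) + norm (U (s - \<tau>) - U (s0 - \<tau>)))"
      by (simp add: eventually_at_filter)
    from Lim_null_comparison[OF this lim] show "(?G \<longlongrightarrow> ?G s0) (at s0 within {0..c})"
      by (simp add: LIM_zero_iff)
  qed
qed

lemma duhamel_well_defined:
  assumes U: "continuous_on {-\<tau>..c} U" "U ` {-\<tau>..c} \<subseteq> X"
  shows duhamel_integrable:
      "\<And>t. t \<in> {0..c} \<Longrightarrow> (\<lambda>s. T (t - s) (forcing U s)) integrable_on {0..t}"
    and duhamel_in: "\<And>t. t \<in> {0..c} \<Longrightarrow> duhamel U t \<in> X"
    and duhamel_continuous: "continuous_on {0..c} (duhamel U)"
proof -
  let ?d = "\<lambda>s. D (U (s - \<tau>))" and ?f = "\<lambda>s. F (U s) (U (s - \<tau>))"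
  have in_X: "?d ` {0..c} \<subseteq> X" "?f ` {0..c} \<subseteq> X"
    using U(2) tau_pos by (auto intro!: D_in F_in simp: image_subset_iff)
  note d = alpha_L1[of c] D_history_continuous[OF U] in_X(1)
  have one: "(\<lambda>_. 1 :: real) absolutely_integrable_on {0..c}"
    by (intro absolutely_integrable_continuous_real continuous_intros)
  note f = one F_history_continuous[OF U] in_X(2)
  have split: "T (t - s) (forcing U s) = \<alpha> s *\<^sub>R T (t - s) (?d s) + 1 *\<^sub>R T (t - s) (?f s)"
    if "s \<in> {0..t}" "t \<le> c" for s t
  proof -
    have "?d s \<in> X" "?f s \<in> X"
      using in_X that by auto
    then show ?thesis
      using that subspace_scale[OF subspace_X] by (simp add: forcing_def T_add T_scale)
  qed
  have sum_int: "(\<lambda>s. \<alpha> s *\<^sub>R T (t - s) (?d s) + 1 *\<^sub>R T (t - s) (?f s)) integrable_on {0..t}"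
    if "t \<in> {0..c}" for t
    by (intro integrable_add convolution_integrable[OF d that] convolution_integrable[OF f that])
  show int: "(\<lambda>s. T (t - s) (forcing U s)) integrable_on {0..t}" if "t \<in> {0..c}" for t
    by (rule integrable_eq[OF sum_int[OF that]]) (use that split in auto)
  show "duhamel U t \<in> X" if t: "t \<in> {0..c}" for t
  proof (rule has_integral_in_closed_subspace[OF closed_X subspace_X])
    show "((\<lambda>s. T (t - s) (forcing U s)) has_integral duhamel U t) {0..t}"
      unfolding duhamel_def by (rule integrable_integral[OF int[OF t]])
    show "T (t - s) (forcing U s) \<in> X" if "s \<in> {0..t}" for s
      using that t U(2) tau_pos by (intro T_in forcing_in) (auto simp: image_subset_iff)
  qed
  have duhamel_split: "duhamel U t = integral {0..t} (\<lambda>s. \<alpha> s *\<^sub>R T (t - s) (?d s))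
      + integral {0..t} (\<lambda>s. 1 *\<^sub>R T (t - s) (?f s))" if "t \<in> {0..c}" for t
  proof -
    have "duhamel U t = integral {0..t} (\<lambda>s. \<alpha> s *\<^sub>R T (t - s) (?d s) + 1 *\<^sub>R T (t - s) (?f s))"
      unfolding duhamel_def using that split by (intro integral_cong) auto
    also have "\<dots> = integral {0..t} (\<lambda>s. \<alpha> s *\<^sub>R T (t - s) (?d s))
        + integral {0..t} (\<lambda>s. 1 *\<^sub>R T (t - s) (?f s))"
      by (intro Henstock_Kurzweil_Integration.integral_add convolution_integrable[OF d that]
          convolution_integrable[OF f that])
    finally show ?thesis .
  qed
  have "continuous_on {0..c} (\<lambda>t. integral {0..t} (\<lambda>s. \<alpha> s *\<^sub>R T (t - s) (?d s))
      + integral {0..t} (\<lambda>s. 1 *\<^sub>R T (t - s) (?f s)))"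
    by (intro continuous_on_add convolution_continuous[OF d] convolution_continuous[OF f])
  then show "continuous_on {0..c} (duhamel U)"
    by (rule continuous_on_eq) (rule duhamel_split[symmetric])
qed

lemma rate_nonneg: "r > 0 \<Longrightarrow> 0 \<le> rate r s"
  using M_pos b_nonneg L_pos[of r] by (simp add: rate_def add_nonneg_nonneg less_imp_le)

lemma alpha_abs_integrable: "(\<lambda>s. \<bar>\<alpha> s\<bar>) integrable_on {0..c}"
  using alpha_L1[of c] unfolding absolutely_integrable_on_def real_norm_def by blast

lemma rate_L1:
  assumes "r > 0"
  shows "rate r absolutely_integrable_on {0..c}"
proof (rule nonnegative_absolutely_integrable_1)
  show "rate r integrable_on {0..c}"
    unfolding rate_def
    by (intro integrable_add integrable_on_mult_right alpha_abs_integrable integrable_const_ivl)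
qed (use assms rate_nonneg in auto)

lemma growth_nonpos_time: "t \<le> 0 \<Longrightarrow> growth r t = 0"
  by (cases "t = 0") (simp_all add: growth_def)

lemma growth_mono:
  assumes "r > 0" "s \<le> t"
  shows "growth r s \<le> growth r t"
  unfolding growth_def
  using assms rate_nonneg set_lebesgue_integral_eq_integral(1)[OF rate_L1[OF assms(1)]]
  by (intro integral_subset_le) auto

lemma growth_nonneg: "r > 0 \<Longrightarrow> 0 \<le> growth r t"
  using growth_mono[of r 0 t] growth_mono[of r t 0] growth_nonpos_time[of 0 r] growth_nonpos_time[of t r]
  by (cases "t \<le> 0") auto

lemma growth_continuous:
  assumes "r > 0"
  shows "continuous_on UNIV (growth r)"
proof (rule continuous_on_UNIV_if_atMost)
  fix c :: real
  have "continuous_on {0..max 0 c} (growth r)"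
    unfolding growth_def
    by (intro indefinite_integral_continuous_1 set_lebesgue_integral_eq_integral(1)[OF rate_L1[OF assms]])
  then have "continuous_on {..c} (\<lambda>t. growth r (max 0 t))"
    by (rule continuous_on_compose2) (auto intro!: continuous_intros)
  moreover have "growth r (max 0 t) = growth r t" for t
    using growth_nonpos_time[of t r] growth_nonpos_time[of 0 r] by (simp add: max_def)
  ultimately show "continuous_on {..c} (growth r)"
    by simp
qed

text \<open>The central estimate. A bound by a multiple of \<open>exp (- \<omega> s + l * growth r s)\<close> reproduces itself
  under the Duhamel map, because the integrand is dominated by the derivative of that exponential;
  the delay does no harm since \<open>growth r\<close> is increasing. With \<open>l = 1\<close> and the zero curve as partner it
  confines the fixed-point iteration to an envelope, with \<open>l = 2\<close> it gives the contraction factor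
  \<open>1/2\<close>.\<close>

lemma duhamel_diff_le:
  assumes l: "l > 0" and K: "K \<ge> 0" and r: "r > 0" and t: "t \<ge> 0"
    and U: "continuous_on {-\<tau>..t} U" "U ` {-\<tau>..t} \<subseteq> X \<inter> cball 0 r"
    and V: "continuous_on {-\<tau>..t} V" "V ` {-\<tau>..t} \<subseteq> X \<inter> cball 0 r"
    and close: "\<And>s. s \<in> {-\<tau>..t} \<Longrightarrow> norm (U s - V s) \<le> K * exp (- \<omega> * s + l * growth r s)"
  shows "norm (duhamel U t - duhamel V t) \<le> K * exp (- \<omega> * t) * ((exp (l * growth r t) - 1) / l)"
proof -
  let ?E = "\<lambda>s. exp (l * growth r s)"
  have UX: "U ` {-\<tau>..t} \<subseteq> X" and VX: "V ` {-\<tau>..t} \<subseteq> X"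
    using U(2) V(2) by auto
  have int_U: "(\<lambda>s. T (t - s) (forcing U s)) integrable_on {0..t}"
    by (rule duhamel_integrable[OF U(1) UX]) (use t in auto)
  have int_V: "(\<lambda>s. T (t - s) (forcing V s)) integrable_on {0..t}"
    by (rule duhamel_integrable[OF V(1) VX]) (use t in auto)
  have "continuous_on {0..t} ?E"
    by (intro continuous_intros continuous_on_subset[OF growth_continuous[OF r]]) auto
  from integrable_L1_scaleR_continuous[OF rate_L1[OF r] this]
  have int_E: "(\<lambda>s. rate r s * ?E s) integrable_on {0..t}"
    by simp
  have pointwise: "norm (T (t - s) (forcing U s) - T (t - s) (forcing V s))
      \<le> K * exp (- \<omega> * t) * (rate r s * ?E s)" if s: "s \<in> {0..t}" for s
  proof -
    define q where "q = K * exp (- \<omega> * s + l * growth r s)"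
    have q_split: "q = K * exp (- \<omega> * s) * ?E s"
      by (simp only: q_def exp_add mult.assoc)
    have q: "q \<ge> 0"
      using K by (simp add: q_def)
    have in_X: "U s \<in> X \<inter> cball 0 r" "U (s - \<tau>) \<in> X \<inter> cball 0 r"
      "V s \<in> X \<inter> cball 0 r" "V (s - \<tau>) \<in> X \<inter> cball 0 r"
      using U(2) V(2) s tau_pos by (auto simp: image_subset_iff)
    have now: "norm (U s - V s) \<le> q"
      using close[of s] s tau_pos by (simp add: q_def)
    have "norm (U (s - \<tau>) - V (s - \<tau>)) \<le> K * exp (- \<omega> * (s - \<tau>) + l * growth r (s - \<tau>))"
      using close[of "s - \<tau>"] s tau_pos by simp
    also have "\<dots> \<le> K * exp (- \<omega> * (s - \<tau>) + l * growth r s)"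
      using K l growth_mono[OF r, of "s - \<tau>" s] tau_pos by (intro mult_left_mono) auto
    also have "- \<omega> * (s - \<tau>) + l * growth r s = \<omega> * \<tau> + (- \<omega> * s + l * growth r s)"
      by (simp add: algebra_simps)
    finally have past: "norm (U (s - \<tau>) - V (s - \<tau>)) \<le> exp (\<omega> * \<tau>) * q"
      by (simp only: q_def exp_add[of "\<omega> * \<tau>"] mult.left_commute[of K])
    have diff: "forcing U s - forcing V s
        = \<alpha> s *\<^sub>R D (U (s - \<tau>) - V (s - \<tau>)) + (F (U s) (U (s - \<tau>)) - F (V s) (V (s - \<tau>)))"
      using in_X by (simp add: forcing_def D_diff algebra_simps)
    have "norm (forcing U s - forcing V s)
        \<le> \<bar>\<alpha> s\<bar> * norm (D (U (s - \<tau>) - V (s - \<tau>))) + norm (F (U s) (U (s - \<tau>)) - F (V s) (V (s - \<tau>)))"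
      unfolding diff by (rule norm_triangle_le) simp
    also have "\<dots> \<le> \<bar>\<alpha> s\<bar> * (b * (exp (\<omega> * \<tau>) * q)) + L r * (q + exp (\<omega> * \<tau>) * q)"
    proof (intro add_mono mult_left_mono)
      have "norm (D (U (s - \<tau>) - V (s - \<tau>))) \<le> b * norm (U (s - \<tau>) - V (s - \<tau>))"
        using in_X by (intro D_bound subspace_diff[OF subspace_X]) auto
      also have "\<dots> \<le> b * (exp (\<omega> * \<tau>) * q)"
        by (intro mult_left_mono past b_nonneg)
      finally show "norm (D (U (s - \<tau>) - V (s - \<tau>))) \<le> b * (exp (\<omega> * \<tau>) * q)" .
      have "norm (F (U s) (U (s - \<tau>)) - F (V s) (V (s - \<tau>)))
          \<le> L r * (norm (U s - V s) + norm (U (s - \<tau>) - V (s - \<tau>)))"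
        using in_X by (intro F_lipschitz[OF r]) auto
      also have "\<dots> \<le> L r * (q + exp (\<omega> * \<tau>) * q)"
        using L_pos[OF r] by (intro mult_left_mono add_mono now past) auto
      finally show "norm (F (U s) (U (s - \<tau>)) - F (V s) (V (s - \<tau>))) \<le> L r * (q + exp (\<omega> * \<tau>) * q)" .
    qed simp
    finally have "M * norm (forcing U s - forcing V s)
        \<le> M * (\<bar>\<alpha> s\<bar> * (b * (exp (\<omega> * \<tau>) * q)) + L r * (q + exp (\<omega> * \<tau>) * q))"
      using M_pos by (intro mult_left_mono) auto
    also have "\<dots> = rate r s * q"
      by (simp add: rate_def algebra_simps)
    finally have forcing_le: "M * norm (forcing U s - forcing V s) \<le> rate r s * q" .
    have "norm (T (t - s) (forcing U s) - T (t - s) (forcing V s))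
        = norm (T (t - s) (forcing U s - forcing V s))"
      using in_X s by (subst T_diff) (auto intro: forcing_in)
    also have "\<dots> \<le> M * exp (- \<omega> * (t - s)) * norm (forcing U s - forcing V s)"
      using in_X s by (intro T_decay subspace_diff[OF subspace_X] forcing_in) auto
    also have "\<dots> \<le> exp (- \<omega> * (t - s)) * (rate r s * q)"
      using forcing_le by (simp add: mult_left_mono mult_ac)
    also have "\<dots> = K * (exp (- \<omega> * (t - s)) * exp (- \<omega> * s)) * (rate r s * ?E s)"
      by (simp add: q_split mult_ac)
    also have "exp (- \<omega> * (t - s)) * exp (- \<omega> * s) = exp (- \<omega> * t)"
      by (simp add: algebra_simps flip: exp_add)
    finally show ?thesis .
  qed
  have "norm (duhamel U t - duhamel V t)
      = norm (integral {0..t} (\<lambda>s. T (t - s) (forcing U s) - T (t - s) (forcing V s)))"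
    unfolding duhamel_def Henstock_Kurzweil_Integration.integral_diff[OF int_U int_V] ..
  also have "\<dots> \<le> integral {0..t} (\<lambda>s. K * exp (- \<omega> * t) * (rate r s * ?E s))"
    by (intro integral_norm_bound_integral integrable_diff int_U int_V integrable_on_mult_right int_E pointwise)
  also have "\<dots> = K * exp (- \<omega> * t) * integral {0..t} (\<lambda>s. rate r s * ?E s)"
    by simp
  also have "\<dots> \<le> K * exp (- \<omega> * t) * ((?E t - 1) / l)"
    using integral_L1_times_exp_primitive_le[OF rate_L1[OF r] rate_nonneg[OF r] t l] K
    by (intro mult_left_mono) (auto simp: growth_def)
  finally show ?thesis .
qed

end

context delayed_semilinear begin

lemma duhamel_zero:
  assumes "t \<ge> 0"
  shows "duhamel (\<lambda>_. 0) t = 0"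
proof -
  have "D 0 = 0"
    using D_bound[OF zero_in_X] by simp
  moreover have "T (t - s) 0 = 0" if "s \<in> {0..t}" for s
    using T_bound[OF _ zero_in_X, of "t - s"] that by simp
  ultimately have "duhamel (\<lambda>_. 0) t = integral {0..t} (\<lambda>_. 0)"
    unfolding duhamel_def by (intro integral_cong) (simp add: forcing_def F_0)
  then show ?thesis
    by simp
qed

text \<open>One application of Banach's theorem on the whole half-line replaces local existence and
  continuation. The curves below the envelope \<open>K * exp (- \<omega> t + growth r t)\<close> with the prescribed
  history form an invariant set, and as the envelope stays below \<open>r\<close>, a single Lipschitz constant
  \<open>L r\<close> serves for all of them at all times. In the supremum norm weighted with
  \<open>exp (- \<omega> t + 2 * growth r t)\<close> the map halves distances.\<close>

lemma global_solution_exists: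
  assumes r: "r > 0"
    and \<phi>: "continuous_on {-\<tau>..0} \<phi>" "\<phi> ` {-\<tau>..0} \<subseteq> X"
    and K: "\<And>s. s \<in> {-\<tau>..0} \<Longrightarrow> norm (\<phi> s) \<le> K" "M * norm (\<phi> 0) \<le> K"
    and envelope: "\<And>t. t \<ge> 0 \<Longrightarrow> K * exp (- \<omega> * t + growth r t) \<le> r"
  shows "\<exists>U. solution \<phi> U \<and> range U \<subseteq> X \<and> (\<forall>t\<ge>0. norm (U t) \<le> r)"
proof -
  have K_nonneg: "K \<ge> 0"
    using K(1)[of 0] tau_pos norm_ge_zero[of "\<phi> 0"] by (simp del: norm_ge_zero)
  have K_le: "K \<le> r"
    using envelope[of 0] growth_nonpos_time[of 0 r] by simp
  let ?g = "growth r"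
  have g_cont: "continuous_on S ?g" for S
    using growth_continuous[OF r] by (rule continuous_on_subset) simp
  \<comment> \<open>The history is frozen before \<open>-\<tau>\<close>, because the fixed-point space consists of functions on the
    whole line.\<close>
  define \<psi> where "\<psi> t = \<phi> (max (-\<tau>) (min 0 t))" for t
  have clamp: "max (-\<tau>) (min 0 t) \<in> {-\<tau>..0}" for t
    using tau_pos by auto
  have psi_cont: "continuous_on S \<psi>" for S
    unfolding \<psi>_def using clamp
    by (intro continuous_on_compose2[OF \<phi>(1)] continuous_intros) auto
  have psi_in: "\<psi> t \<in> X" and psi_le: "norm (\<psi> t) \<le> K" for t
    using clamp[of t] \<phi>(2) K(1) by (auto simp: \<psi>_def)
  have psi_eq: "\<psi> s = \<phi> s" if "s \<in> {-\<tau>..0}" for s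
    using that by (simp add: \<psi>_def)
  define w where "w t = exp (- \<omega> * t + 2 * ?g t)" for t
  have w_pos: "w t > 0" for t
    by (simp add: w_def)
  have w_cont: "continuous_on S w" for S
    unfolding w_def by (intro continuous_intros g_cont)
  \<comment> \<open>\<open>Z\<close> consists of the curves divided by the weight \<open>w\<close>; \<open>un\<close> undoes the division. The bound
    on \<open>x\<close> is the envelope divided by \<open>w\<close>.\<close>
  define Z where "Z = PiC UNIV (\<lambda>t. {x \<in> X. norm x \<le> K * exp (- ?g t) \<and> (t \<le> 0 \<longrightarrow> w t *\<^sub>R x = \<psi> t)})"
  define un where "un W t = w t *\<^sub>R apply_bcontfun W t" for W :: "real \<Rightarrow>\<^sub>C 'a" and t
  have Z_iff: "W \<in> Z \<longleftrightarrow> (\<forall>t. apply_bcontfun W t \<in> X \<and> norm (apply_bcontfun W t) \<le> K * exp (- ?g t) \<and>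
      (t \<le> 0 \<longrightarrow> un W t = \<psi> t))" for W
    by (auto simp: Z_def mem_PiC_iff un_def)
  have Z_closed: "closed Z"
    unfolding Z_def
  proof (rule closed_PiC)
    fix t :: real
    have "closed (X \<inter> {x. norm x \<le> K * exp (- ?g t)} \<inter> {x. t \<le> 0 \<longrightarrow> w t *\<^sub>R x = \<psi> t})"
      by (intro closed_Int closed_X closed_Collect_le closed_Collect_imp closed_Collect_eq
          continuous_intros open_Collect_const)
    then show "closed {x \<in> X. norm x \<le> K * exp (- ?g t) \<and> (t \<le> 0 \<longrightarrow> w t *\<^sub>R x = \<psi> t)}"
      by (rule back_subst[of closed]) auto
  qed
  have un_cont: "continuous_on S (un W)" for S W
    unfolding un_def by (intro continuous_on_scaleR w_cont continuous_on_apply_bcontfun)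
  have un_in: "un W t \<in> X" if "W \<in> Z" for W t
    using that subspace_scale[OF subspace_X] by (simp add: Z_iff un_def)
  have un_le: "norm (un W t) \<le> K * exp (- \<omega> * t + ?g t)" if "W \<in> Z" for W t
  proof -
    have "norm (un W t) \<le> w t * (K * exp (- ?g t))"
      using that w_pos[of t] by (simp add: un_def Z_iff)
    also have "\<dots> = K * exp (- \<omega> * t + ?g t)"
      by (simp add: w_def mult.left_commute[of _ K] flip: exp_add)
    finally show ?thesis .
  qed
  have un_le_r: "norm (un W t) \<le> r" if "W \<in> Z" for W t
  proof (cases "t \<le> 0")
    case True
    then show ?thesis
      using that psi_le[of t] K_le by (simp add: Z_iff)
  next
    case False
    then show ?thesis
      using un_le[OF that, of t] envelope[of t] by simp
  qed
  have un_hist: "continuous_on {-\<tau>..c} (un W)" "un W ` {-\<tau>..c} \<subseteq> X"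
    "un W ` {-\<tau>..c} \<subseteq> X \<inter> cball 0 r" if "W \<in> Z" for W c
    using un_cont un_in[OF that] un_le_r[OF that] by auto
  define P where "P W t = (if t \<le> 0 then \<psi> t else T t (\<phi> 0) + duhamel (un W) t)" for W t
  have phi0: "\<phi> 0 \<in> X"
    using psi_in[of 0] psi_eq[of 0] tau_pos by simp
  have P_nonneg: "P W t = T t (\<phi> 0) + duhamel (un W) t" if "t \<ge> 0" for W t
    using that T_0[OF phi0] psi_eq[of 0] tau_pos by (auto simp: P_def duhamel_def)
  have P_cont: "continuous_on S (P W)" if W: "W \<in> Z" for S W
  proof -
    have "continuous_on {..c} (P W)" for c
    proof -
      have "continuous_on {0..max 0 c} (\<lambda>t. T t (\<phi> 0))"
        by (rule continuous_on_compose2[OF T_jointly_continuous, of _ "\<lambda>t. (t, \<phi> 0)", simplified])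
          (use phi0 in \<open>auto intro!: continuous_intros\<close>)
      then have "continuous_on {0..max 0 c} (\<lambda>t. T t (\<phi> 0) + duhamel (un W) t)"
        by (intro continuous_on_add duhamel_continuous un_hist W)
      then have "continuous_on {0..max 0 c} (P W)"
        by (rule continuous_on_eq) (simp add: P_nonneg)
      moreover have "continuous_on {..0} (P W)"
        by (rule continuous_on_eq[OF psi_cont]) (simp add: P_def)
      ultimately have "continuous_on ({..0} \<union> {0..max 0 c}) (P W)"
        by (intro continuous_on_closed_Un) auto
      then show ?thesis
        by (rule continuous_on_subset) auto
    qed
    then show ?thesis
      using continuous_on_UNIV_if_atMost continuous_on_subset by blast
  qed
  have P_in: "P W t \<in> X" if W: "W \<in> Z" for W t
  proof (cases "t \<le> 0")
    case False
    then have "duhamel (un W) t \<in> X"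
      by (intro duhamel_in[OF un_hist(1,2)[OF W], of t t]) auto
    then show ?thesis
      using False T_in[OF _ phi0, of t] by (simp add: P_def subspace_add[OF subspace_X])
  qed (simp add: P_def psi_in)
  have P_le: "norm (P W t) \<le> K * exp (- \<omega> * t + ?g t)" if W: "W \<in> Z" for W t
  proof (cases "t \<le> 0")
    case True
    have "K * 1 \<le> K * exp (- \<omega> * t + ?g t)"
      using True K_nonneg omega_pos growth_nonpos_time[OF True, of r]
      by (intro mult_left_mono) (auto simp: mult_nonneg_nonpos)
    then show ?thesis
      using psi_le[of t] True by (simp add: P_def)
  next
    case False
    have "norm (duhamel (un W) t - duhamel (\<lambda>_. 0) t) \<le> K * exp (- \<omega> * t) * ((exp (1 * ?g t) - 1) / 1)"
      by (rule duhamel_diff_le)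
        (use False W K_nonneg r un_hist un_le zero_in_X in \<open>auto intro!: continuous_intros\<close>)
    then have "norm (duhamel (un W) t) \<le> K * exp (- \<omega> * t) * (exp (?g t) - 1)"
      using duhamel_zero[of t] False by simp
    moreover have "norm (T t (\<phi> 0)) \<le> K * exp (- \<omega> * t)"
    proof -
      have "norm (T t (\<phi> 0)) \<le> exp (- \<omega> * t) * (M * norm (\<phi> 0))"
        using T_decay[OF _ phi0, of t] False by (simp add: mult_ac)
      also have "\<dots> \<le> exp (- \<omega> * t) * K"
        by (intro mult_left_mono K) simp
      finally show ?thesis
        by (simp add: mult.commute)
    qed
    moreover have "K * exp (- \<omega> * t) + K * exp (- \<omega> * t) * (exp (?g t) - 1) = K * exp (- \<omega> * t + ?g t)"
      by (subst exp_add) (simp add: algebra_simps)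
    ultimately show ?thesis
      using False norm_triangle_ineq[of "T t (\<phi> 0)" "duhamel (un W) t"] by (simp add: P_def)
  qed
  define \<Psi> where "\<Psi> W = Bcontfun (\<lambda>t. (1 / w t) *\<^sub>R P W t)" for W
  have scaled_le: "norm ((1 / w t) *\<^sub>R P W t) \<le> K * exp (- ?g t)" if W: "W \<in> Z" for W t
  proof -
    have "norm ((1 / w t) *\<^sub>R P W t) \<le> (K * exp (- \<omega> * t + ?g t)) / w t"
      using P_le[OF W, of t] w_pos[of t] by (simp add: divide_right_mono)
    also have "\<dots> = K * exp (- ?g t)"
      unfolding w_def times_divide_eq_right[symmetric] exp_diff[symmetric] by simp
    finally show ?thesis .
  qed
  have Psi_apply: "apply_bcontfun (\<Psi> W) t = (1 / w t) *\<^sub>R P W t" if W: "W \<in> Z" for W t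
  proof -
    have "(\<lambda>t. (1 / w t) *\<^sub>R P W t) \<in> bcontfun"
    proof (rule bcontfun_normI)
      show "continuous_on UNIV (\<lambda>t. (1 / w t) *\<^sub>R P W t)"
        by (intro continuous_intros P_cont W w_cont) (simp add: w_def)
      have "K * exp (- ?g t) \<le> K * 1" for t
        using K_nonneg growth_nonneg[OF r] by (intro mult_left_mono) auto
      then show "norm ((1 / w t) *\<^sub>R P W t) \<le> K" for t
        using scaled_le[OF W, of t] by (metis mult.right_neutral order_trans)
    qed
    then show ?thesis
      by (simp add: \<Psi>_def Bcontfun_inverse)
  qed
  have un_Psi: "un (\<Psi> W) t = P W t" if "W \<in> Z" for W t
    using w_pos[of t] by (simp add: un_def Psi_apply[OF that])
  have Psi_Z: "\<Psi> W \<in> Z" if W: "W \<in> Z" for W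
    unfolding Z_iff
  proof (intro allI conjI impI)
    fix t
    show "apply_bcontfun (\<Psi> W) t \<in> X"
      using P_in[OF W] subspace_scale[OF subspace_X] by (simp add: Psi_apply[OF W])
    show "norm (apply_bcontfun (\<Psi> W) t) \<le> K * exp (- ?g t)"
      using scaled_le[OF W] by (simp add: Psi_apply[OF W])
    show "un (\<Psi> W) t = \<psi> t" if "t \<le> 0"
      using that by (simp add: un_Psi[OF W] P_def)
  qed
  have contraction: "dist (\<Psi> V) (\<Psi> W) \<le> (1/2) * dist V W" if V: "V \<in> Z" and W: "W \<in> Z" for V W
  proof (rule dist_bound)
    fix t
    define d where "d = dist V W"
    have close: "norm (un V s - un W s) \<le> d * exp (- \<omega> * s + 2 * ?g s)" for s
    proof -
      have "norm (un V s - un W s) = w s * dist (apply_bcontfun V s) (apply_bcontfun W s)"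
        using w_pos[of s] by (simp add: un_def dist_norm flip: scaleR_diff_right)
      also have "\<dots> \<le> w s * d"
        using w_pos[of s] dist_bounded[of V s W] by (simp add: d_def)
      finally show ?thesis
        by (simp add: w_def mult.commute)
    qed
    have "norm (P V t - P W t) \<le> d / 2 * w t"
    proof (cases "t \<le> 0")
      case True
      then show ?thesis
        using w_pos[of t] by (simp add: P_def d_def)
    next
      case False
      have "norm (duhamel (un V) t - duhamel (un W) t) \<le> d * exp (- \<omega> * t) * ((exp (2 * ?g t) - 1) / 2)"
        by (rule duhamel_diff_le) (use False V W r un_hist close in \<open>auto simp: d_def\<close>)
      also have "\<dots> = d / 2 * w t - d / 2 * exp (- \<omega> * t)"
        unfolding w_def by (subst exp_add) (simp add: field_simps)
      also have "\<dots> \<le> d / 2 * w t"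
        by (simp add: d_def)
      finally show ?thesis
        using False by (simp add: P_def)
    qed
    then have "norm (P V t - P W t) / w t \<le> d / 2"
      using w_pos[of t] by (simp add: pos_divide_le_eq)
    then show "dist (apply_bcontfun (\<Psi> V) t) (apply_bcontfun (\<Psi> W) t) \<le> (1/2) * dist V W"
      using w_pos[of t]
      by (simp add: Psi_apply V W dist_norm d_def flip: scaleR_diff_right)
  qed
  have "Z \<noteq> {}"
  proof -
    \<comment> \<open>The history divided by \<open>w\<close>, continued by its value at 0 damped so as to respect the envelope.\<close>
    let ?W = "\<lambda>t. (exp (\<omega> * min 0 t) * exp (- ?g t)) *\<^sub>R \<psi> t"
    have le: "norm (?W t) \<le> K * exp (- ?g t)" for t
    proof -
      have "exp (\<omega> * min 0 t) * norm (\<psi> t) \<le> 1 * K"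
        using omega_pos by (intro mult_mono psi_le) (auto simp: mult_nonneg_nonpos)
      then have "exp (- ?g t) * (exp (\<omega> * min 0 t) * norm (\<psi> t)) \<le> exp (- ?g t) * K"
        by (intro mult_left_mono) auto
      then show ?thesis
        by (simp add: abs_mult mult_ac)
    qed
    have "?W \<in> bcontfun"
    proof (rule bcontfun_normI)
      show "continuous_on UNIV ?W"
        by (intro continuous_intros psi_cont g_cont)
      have "K * exp (- ?g t) \<le> K * 1" for t
        using K_nonneg growth_nonneg[OF r] by (intro mult_left_mono) auto
      then show "norm (?W t) \<le> K" for t
        using le[of t] by (metis mult.right_neutral order_trans)
    qed
    then have apply_W: "apply_bcontfun (Bcontfun ?W) t = ?W t" for t
      by (simp add: Bcontfun_inverse)
    have "Bcontfun ?W \<in> Z"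
      unfolding Z_iff
    proof (intro allI conjI impI)
      fix t
      show "apply_bcontfun (Bcontfun ?W) t \<in> X"
        unfolding apply_W by (intro subspace_scale[OF subspace_X] psi_in)
      show "norm (apply_bcontfun (Bcontfun ?W) t) \<le> K * exp (- ?g t)"
        unfolding apply_W by (rule le)
      show "un (Bcontfun ?W) t = \<psi> t" if "t \<le> 0"
        unfolding un_def apply_W w_def
        using that growth_nonpos_time[OF that, of r] by (simp flip: exp_add)
    qed
    then show ?thesis
      by blast
  qed
  moreover have "complete Z"
    using Z_closed by (simp add: complete_eq_closed)
  ultimately have "\<exists>!W\<in>Z. \<Psi> W = W"
    by (intro Banach_fix[where c = "1/2"] contraction) (use Psi_Z in auto)
  then obtain W where W: "W \<in> Z" "\<Psi> W = W"
    by blast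
  have un_eq: "un W t = P W t" for t
    using un_Psi[OF W(1), of t] by (simp add: W(2))
  have "solution \<phi> (un W)"
    unfolding solution_def
  proof (intro conjI allI ballI impI)
    show "un W t \<in> X" for t
      by (rule un_in[OF W(1)])
    show "continuous_on {-\<tau>..} (un W)"
      by (rule un_cont)
    show history: "un W s = \<phi> s" if "s \<in> {-\<tau>..0}" for s
      using that by (simp add: un_eq P_def psi_eq)
    fix t :: real assume t: "t \<ge> 0"
    have "un W t - T t (un W 0) = duhamel (un W) t"
      using history[of 0] tau_pos un_eq[of t] P_nonneg[OF t, of W] by simp
    moreover have "((\<lambda>s. T (t - s) (forcing (un W) s)) has_integral duhamel (un W) t) {0..t}"
      unfolding duhamel_def
      by (intro integrable_integral duhamel_integrable[OF un_hist(1,2)[OF W(1)]]) (use t in auto)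
    ultimately show "((\<lambda>s. T (t - s) (forcing (un W) s)) has_integral un W t - T t (un W 0)) {0..t}"
      by simp
  qed
  then show ?thesis
    using un_le_r[OF W(1)] un_in[OF W(1)] by blast
qed

text \<open>The competitor need not respect any envelope, but on a compact interval both curves are bounded by
  some \<open>r\<close>. Where the weighted distance is largest, the central estimate with \<open>l = 2\<close> bounds it by
  half of itself.\<close>

lemma solution_unique:
  assumes U: "solution \<phi> U" and V: "solution \<phi> V" and t: "t \<ge> -\<tau>"
  shows "U t = V t"
proof (cases "t \<le> 0")
  case True
  then show ?thesis
    using U V t by (simp add: solution_def)
next
  case False
  have cont: "continuous_on {-\<tau>..c} U" "continuous_on {-\<tau>..c} V" for c
    using U V unfolding solution_def by (auto elim: continuous_on_subset)
  have in_X: "U s \<in> X" "V s \<in> X" if "s \<ge> -\<tau>" for s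
    using U V that by (simp_all add: solution_def)
  have history: "U s = V s" if "s \<in> {-\<tau>..0}" for s
    using U V that by (simp add: solution_def)
  have formula: "U s - V s = duhamel U s - duhamel V s" if "s \<ge> 0" for s
  proof -
    have "duhamel U s = U s - T s (U 0)" "duhamel V s = V s - T s (V 0)"
      using U V that by (auto simp: solution_def duhamel_def intro!: integral_unique)
    then show ?thesis
      using history[of 0] tau_pos by simp
  qed
  have "bounded (U ` {-\<tau>..t} \<union> V ` {-\<tau>..t})"
    using cont by (intro bounded_Un[THEN iffD2] conjI compact_imp_bounded compact_continuous_image) auto
  then obtain r where r: "r > 0" "\<forall>x \<in> U ` {-\<tau>..t} \<union> V ` {-\<tau>..t}. norm x \<le> r"
    unfolding bounded_pos by blast
  define q where "q s = norm (U s - V s) * exp (\<omega> * s - 2 * growth r s)" for s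
  have "continuous_on {0..t} q"
    unfolding q_def using tau_pos
    by (intro continuous_intros continuous_on_subset[OF growth_continuous[OF r(1)]]
        continuous_on_subset[OF cont(1)[of t]] continuous_on_subset[OF cont(2)[of t]]) auto
  then obtain s where s: "s \<in> {0..t}" "\<And>s'. s' \<in> {0..t} \<Longrightarrow> q s' \<le> q s"
    using continuous_attains_sup[of "{0..t}" q] False by auto
  have q_nonneg: "q s' \<ge> 0" for s'
    by (simp add: q_def)
  have norm_eq: "norm (U s' - V s') = q s' * exp (- \<omega> * s' + 2 * growth r s')" for s'
    by (simp add: q_def mult.assoc flip: exp_add)
  have close: "norm (U s' - V s') \<le> q s * exp (- \<omega> * s' + 2 * growth r s')" if "s' \<in> {-\<tau>..s}" for s'
  proof (cases "s' \<le> 0")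
    case True
    then show ?thesis
      using history[of s'] that q_nonneg[of s] by simp
  next
    case False
    then show ?thesis
      unfolding norm_eq[of s'] using s that by (intro mult_right_mono) auto
  qed
  have "norm (duhamel U s - duhamel V s)
      \<le> q s * exp (- \<omega> * s) * ((exp (2 * growth r s) - 1) / 2)"
    by (rule duhamel_diff_le)
      (use s(1) r q_nonneg cont in_X close in \<open>auto simp: image_subset_iff\<close>)
  also have "\<dots> = (q s * exp (- \<omega> * s + 2 * growth r s)) / 2 - q s * exp (- \<omega> * s) / 2"
    by (subst exp_add) (simp add: field_simps)
  finally have "q s * (exp (- \<omega> * s + 2 * growth r s) + exp (- \<omega> * s)) \<le> 0"
    unfolding formula[of s, symmetric, OF s(1)[THEN atLeastAtMost_iff[THEN iffD1], THEN conjunct1]] norm_eq[of s]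
    by (simp add: algebra_simps)
  then have "q s \<le> 0"
    using add_pos_pos[OF exp_gt_zero exp_gt_zero] by (metis mult_pos_pos not_le)
  then have "q t \<le> 0"
    using s(2)[of t] False by simp
  then show ?thesis
    by (simp add: q_def mult_le_0_iff)
qed

end

lemma integral_translate:
  fixes f :: "real \<Rightarrow> 'a::banach"
  assumes "f integrable_on {a + c..b + c}"
  shows "integral {a..b} (\<lambda>x. f (x + c)) = integral {a + c..b + c} f"
proof (rule integral_unique)
  have "(f has_integral integral {a + c..b + c} f) (cbox (a + c) (b + c))"
    using assms by (simp add: integrable_integral)
  from has_integral_affinity[OF this, of 1 c]
  have "((\<lambda>x. f (x + c)) has_integral integral {a + c..b + c} f) ((\<lambda>x. - c + x) ` {a + c..b + c})"
    by (simp add: algebra_simps)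
  then show "((\<lambda>x. f (x + c)) has_integral integral {a + c..b + c} f) {a..b}"
    by (simp only: image_add_atLeastAtMost) (simp add: algebra_simps)
qed

context delayed_semilinear begin

text \<open>The hypothesis on \<open>\<alpha>\<close> controls the mass of \<open>\<alpha>\<close> from time \<open>\<tau>\<close> on; the mass on \<open>[0, \<tau>]\<close> enters as
  a constant. The linear rates \<open>\<omega>'\<close> of the delay term and \<open>\<omega> - \<omega>'\<close> of the nonlinearity add up to at
  most \<open>\<omega>\<close>, which the decay of the semigroup compensates.\<close>

lemma growth_le:
  assumes r: "r > 0" and t: "t \<ge> 0"
    and delayed: "\<And>t. t > 0 \<Longrightarrow>
          M * b * exp (\<omega> * \<tau>) * integral {0..t} (\<lambda>s. \<bar>\<alpha> (s + \<tau>)\<bar>) \<le> \<gamma> + \<omega>' * t"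
    and gamma: "\<gamma> \<ge> 0" and L: "M * L r * (1 + exp (\<omega> * \<tau>)) \<le> \<omega> - \<omega>'"
  shows "growth r t \<le> M * b * exp (\<omega> * \<tau>) * integral {0..\<tau>} (\<lambda>s. \<bar>\<alpha> s\<bar>) + \<gamma> + \<omega> * t"
proof -
  let ?m = "M * b * exp (\<omega> * \<tau>)"
  have m: "?m \<ge> 0"
    using M_pos b_nonneg by simp
  have int: "(\<lambda>s. \<bar>\<alpha> s\<bar>) integrable_on {u..v}" if "u \<ge> 0" for u v
    by (rule integrable_on_subinterval[OF alpha_abs_integrable[of v]]) (use that in auto)
  have "integral {0..t} (\<lambda>s. \<bar>\<alpha> s\<bar>) \<le> integral {0..t + \<tau>} (\<lambda>s. \<bar>\<alpha> s\<bar>)"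
    using tau_pos by (intro integral_subset_le int) auto
  also have "\<dots> = integral {0..\<tau>} (\<lambda>s. \<bar>\<alpha> s\<bar>) + integral {0 + \<tau>..t + \<tau>} (\<lambda>s. \<bar>\<alpha> s\<bar>)"
    using tau_pos t Henstock_Kurzweil_Integration.integral_combine[of 0 \<tau> "t + \<tau>" "\<lambda>s. \<bar>\<alpha> s\<bar>"]
      int[of 0 "t + \<tau>"] by simp
  also have "integral {0 + \<tau>..t + \<tau>} (\<lambda>s. \<bar>\<alpha> s\<bar>) = integral {0..t} (\<lambda>s. \<bar>\<alpha> (s + \<tau>)\<bar>)"
    using tau_pos by (intro integral_translate[symmetric] int) auto
  finally have "?m * integral {0..t} (\<lambda>s. \<bar>\<alpha> s\<bar>)
      \<le> ?m * (integral {0..\<tau>} (\<lambda>s. \<bar>\<alpha> s\<bar>) + integral {0..t} (\<lambda>s. \<bar>\<alpha> (s + \<tau>)\<bar>))"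
    using m by (rule mult_left_mono)
  moreover have "?m * integral {0..t} (\<lambda>s. \<bar>\<alpha> (s + \<tau>)\<bar>) \<le> \<gamma> + \<omega>' * t"
    using delayed[of t] t gamma by (cases "t = 0") auto
  ultimately have "?m * integral {0..t} (\<lambda>s. \<bar>\<alpha> s\<bar>)
      \<le> ?m * integral {0..\<tau>} (\<lambda>s. \<bar>\<alpha> s\<bar>) + \<gamma> + \<omega>' * t"
    unfolding distrib_left by linarith
  moreover have "growth r t = ?m * integral {0..t} (\<lambda>s. \<bar>\<alpha> s\<bar>) + t * (M * L r * (1 + exp (\<omega> * \<tau>)))"
  proof -
    have "growth r t = integral {0..t} (\<lambda>s. ?m * \<bar>\<alpha> s\<bar>) + integral {0..t} (\<lambda>s. M * L r * (1 + exp (\<omega> * \<tau>)))"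
      unfolding growth_def rate_def
      by (intro Henstock_Kurzweil_Integration.integral_add integrable_on_mult_right int integrable_const_ivl) simp
    then show ?thesis
      using t by simp
  qed
  moreover have "t * (M * L r * (1 + exp (\<omega> * \<tau>))) \<le> t * (\<omega> - \<omega>')"
    using L t by (rule mult_left_mono)
  ultimately show ?thesis
    by (simp add: algebra_simps)
qed

end

section \<open>The energy space as a subspace of a Banach space\<close>

text \<open>The sort \<open>{real_inner, complete_space}\<close> does not entail the type class \<open>banach\<close>, although its types
  satisfy the axioms of that class. This copy carries the instance; norms, limits and integrals
  pass to it along the linear isometry \<open>to_copy\<close>.\<close>

typedef 'a banach_copy = "UNIV :: 'a set"
  morphisms of_copy to_copy ..

setup_lifting type_definition_banach_copy

instantiation banach_copy :: (real_normed_vector) real_normed_vector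
begin

lift_definition zero_banach_copy :: "'a banach_copy" is 0 .
lift_definition plus_banach_copy :: "'a banach_copy \<Rightarrow> 'a banach_copy \<Rightarrow> 'a banach_copy" is plus .
lift_definition minus_banach_copy :: "'a banach_copy \<Rightarrow> 'a banach_copy \<Rightarrow> 'a banach_copy" is minus .
lift_definition uminus_banach_copy :: "'a banach_copy \<Rightarrow> 'a banach_copy" is uminus .
lift_definition scaleR_banach_copy :: "real \<Rightarrow> 'a banach_copy \<Rightarrow> 'a banach_copy" is scaleR .
lift_definition norm_banach_copy :: "'a banach_copy \<Rightarrow> real" is norm .
lift_definition sgn_banach_copy :: "'a banach_copy \<Rightarrow> 'a banach_copy" is sgn .
lift_definition dist_banach_copy :: "'a banach_copy \<Rightarrow> 'a banach_copy \<Rightarrow> real" is dist .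

definition uniformity_banach_copy :: "('a banach_copy \<times> 'a banach_copy) filter" where
  "uniformity_banach_copy = (INF e\<in>{0<..}. principal {(x, y). dist x y < e})"

definition open_banach_copy :: "'a banach_copy set \<Rightarrow> bool" where
  "open_banach_copy U \<longleftrightarrow> (\<forall>x\<in>U. \<forall>\<^sub>F (x', y) in uniformity. x' = x \<longrightarrow> y \<in> U)"

instance
proof
  fix x y z :: "'a banach_copy" and a b :: real
  show "x + y + z = x + (y + z)" "x + y = y + x" "0 + x = x" "- x + x = 0" "x - y = x + - y"
    "a *\<^sub>R (x + y) = a *\<^sub>R x + a *\<^sub>R y" "(a + b) *\<^sub>R x = a *\<^sub>R x + b *\<^sub>R x"
    "a *\<^sub>R b *\<^sub>R x = (a * b) *\<^sub>R x" "1 *\<^sub>R x = x"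
    by (transfer, simp add: algebra_simps)+
  show "dist x y = norm (x - y)" "norm (a *\<^sub>R x) = \<bar>a\<bar> * norm x" "sgn x = inverse (norm x) *\<^sub>R x"
    "norm x = 0 \<longleftrightarrow> x = 0"
    by (transfer, simp add: dist_norm sgn_div_norm)+
  show "norm (x + y) \<le> norm x + norm y"
    by transfer (rule norm_triangle_ineq)
qed (simp_all add: uniformity_banach_copy_def open_banach_copy_def)

end

instance banach_copy :: ("{real_normed_vector,complete_space}") banach
proof
  fix X :: "nat \<Rightarrow> 'a banach_copy"
  assume "Cauchy X"
  then have "Cauchy (\<lambda>n. of_copy (X n))"
    by (simp add: Cauchy_altdef2 dist_banach_copy.rep_eq)
  then obtain l where "(\<lambda>n. of_copy (X n)) \<longlonglongrightarrow> l"
    using Cauchy_convergent convergent_def by blast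
  then have "(\<lambda>n. dist (X n) (to_copy l)) \<longlonglongrightarrow> 0"
    by (subst (asm) tendsto_dist_iff) (simp add: dist_banach_copy.rep_eq to_copy_inverse)
  then have "X \<longlonglongrightarrow> to_copy l"
    by (subst tendsto_dist_iff)
  then show "convergent X"
    by (rule convergentI)
qed

lemma bounded_linear_to_copy: "bounded_linear (to_copy :: 'a::{real_normed_vector,complete_space} \<Rightarrow> _)"
  by (rule bounded_linear_intro[where K = 1])
    (simp_all add: plus_banach_copy.abs_eq scaleR_banach_copy.abs_eq norm_banach_copy.abs_eq)

lemma bounded_linear_of_copy: "bounded_linear (of_copy :: 'a::{real_normed_vector,complete_space} banach_copy \<Rightarrow> _)"
  by (rule bounded_linear_intro[where K = 1])
    (simp_all add: plus_banach_copy.rep_eq scaleR_banach_copy.rep_eq norm_banach_copy.rep_eq)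

lemma of_to_copy [simp]: "of_copy (to_copy x) = x"
  by (rule to_copy_inverse) simp

lemma continuous_on_to_copy_iff:
  fixes f :: "'b::topological_space \<Rightarrow> 'a::{real_normed_vector,complete_space}"
  shows "continuous_on A (\<lambda>t. to_copy (f t)) \<longleftrightarrow> continuous_on A f"
  using bounded_linear.continuous_on[OF bounded_linear_to_copy, of A f]
    bounded_linear.continuous_on[OF bounded_linear_of_copy, of A "\<lambda>t. to_copy (f t)"] by auto

lemma has_integral_to_copy_iff:
  fixes f :: "real \<Rightarrow> 'a::{real_normed_vector,complete_space}"
  shows "((\<lambda>t. to_copy (f t)) has_integral to_copy y) A \<longleftrightarrow> (f has_integral y) A"
  using has_integral_linear[OF _ bounded_linear_to_copy, of f y A]
    has_integral_linear[OF _ bounded_linear_of_copy, of "\<lambda>t. to_copy (f t)" "to_copy y" A]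
  by (auto simp: o_def)

text \<open>If the square root is injective, the energy space is isometric to its image under \<open>E\<close>, a subspace
  of a Banach space on which the abstract results apply.\<close>

locale energy_isometry =
  fixes DR :: "'h::{real_inner,complete_space} set" and R :: "'h \<Rightarrow> 'h"
  assumes subspace_DR: "subspace DR"
    and R_linear: "linear_map_on DR R"
    and R_injective: "\<And>u. u \<in> DR \<Longrightarrow> R u = 0 \<Longrightarrow> u = 0"
begin

abbreviation es :: "('h \<times> 'h) set" where "es \<equiv> energy_space DR"

definition E :: "'h \<times> 'h \<Rightarrow> ('h \<times> 'h) banach_copy" where "E U = to_copy (energy_map R U)"

definition E_inv :: "('h \<times> 'h) banach_copy \<Rightarrow> 'h \<times> 'h" where "E_inv = inv_into es E"

lemma subspace_es: "subspace es"
  unfolding energy_space_def by (rule subspace_Times[OF subspace_DR subspace_UNIV])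

lemma R_diff:
  assumes "u \<in> DR" "v \<in> DR"
  shows "R (u - v) = R u - R v"
proof -
  have "- 1 *\<^sub>R v \<in> DR"
    using assms subspace_DR by (blast intro: subspace_scale)
  then have "R (u + - 1 *\<^sub>R v) = R u + R (- 1 *\<^sub>R v)" "R (- 1 *\<^sub>R v) = - 1 *\<^sub>R R v"
    using R_linear assms unfolding linear_map_on_def by blast+
  then show ?thesis
    by simp
qed

lemma R_0: "R 0 = 0"
  using R_diff[of 0 0] subspace_0[OF subspace_DR] by simp

lemma norm_E: "norm (E U) = energy_norm R U"
  by (simp add: E_def norm_banach_copy.rep_eq norm_energy_map)

lemma norm_R_fst_le: "norm (R (fst U)) \<le> norm (E U)"
  using norm_fst_le[of "R (fst U)" "snd U"]
  by (simp add: E_def norm_banach_copy.rep_eq energy_map_def)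

lemma norm_snd_le_E: "norm (snd U) \<le> norm (E U)"
  using norm_snd_le[of "snd U" "R (fst U)"]
  by (simp add: E_def norm_banach_copy.rep_eq energy_map_def)

lemma norm_E_velocity: "norm (E (0, z)) = norm z"
  by (simp add: E_def norm_banach_copy.rep_eq energy_map_def R_0 norm_Pair)

lemma E_add: "U \<in> es \<Longrightarrow> V \<in> es \<Longrightarrow> E (U + V) = E U + E V"
  using R_linear
  by (auto simp: E_def energy_map_def energy_space_def linear_map_on_def plus_banach_copy.abs_eq)

lemma E_scale: "U \<in> es \<Longrightarrow> E (c *\<^sub>R U) = c *\<^sub>R E U"
  using R_linear
  by (auto simp: E_def energy_map_def energy_space_def linear_map_on_def scaleR_banach_copy.abs_eq)

lemma E_diff: "U \<in> es \<Longrightarrow> V \<in> es \<Longrightarrow> E (U - V) = E U - E V"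
  by (auto simp: E_def energy_map_def energy_space_def R_diff minus_banach_copy.abs_eq)

lemma E_inj: "inj_on E es"
proof (rule inj_onI)
  fix U V assume U: "U \<in> es" and V: "V \<in> es" and "E U = E V"
  then have "norm (E (U - V)) = 0"
    by (simp add: E_diff)
  then have "norm (R (fst (U - V))) \<le> 0" "norm (snd (U - V)) \<le> 0"
    using norm_R_fst_le[of "U - V"] norm_snd_le_E[of "U - V"] by simp_all
  moreover have "fst (U - V) \<in> DR"
    using U V subspace_diff[OF subspace_DR] by (auto simp: energy_space_def)
  ultimately show "U = V"
    using R_injective[of "fst (U - V)"] by (simp add: prod_eq_iff)
qed

lemma E_inv_E [simp]: "U \<in> es \<Longrightarrow> E_inv (E U) = U"
  unfolding E_inv_def by (rule inv_into_f_f[OF E_inj])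

lemma subspace_range_E: "subspace (E ` es)"
proof (rule subspaceI)
  show "0 \<in> E ` es"
    using E_scale[OF subspace_0[OF subspace_es], of 0] subspace_0[OF subspace_es] by (auto simp: image_iff)
  have "E U + E V \<in> E ` es" if "U \<in> es" "V \<in> es" for U V
    unfolding E_add[OF that, symmetric] by (intro imageI subspace_add[OF subspace_es] that)
  then show "x + y \<in> E ` es" if "x \<in> E ` es" "y \<in> E ` es" for x y
    using that by blast
  have "c *\<^sub>R E U \<in> E ` es" if "U \<in> es" for c U
    unfolding E_scale[OF that, symmetric] by (intro imageI subspace_scale[OF subspace_es] that)
  then show "c *\<^sub>R x \<in> E ` es" if "x \<in> E ` es" for c x
    using that by blast
qed

text \<open>The delay term and the nonlinearity have values of this form, so they never leave the energy
  space.\<close>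

lemma velocity_in_es: "(0, z) \<in> es"
  using subspace_0[OF subspace_DR] by (simp add: energy_space_def)

end

section \<open>The delayed wave equation\<close>

locale delayed_wave = energy_isometry DR R
  for DR :: "'h::{real_inner,complete_space} set" and R :: "'h \<Rightarrow> 'h" +
  fixes B :: "'h \<Rightarrow> 'h" and \<psi>1 \<psi>2 :: "'h \<Rightarrow> real" and S :: "real \<Rightarrow> 'h \<times> 'h \<Rightarrow> 'h \<times> 'h"
    and \<alpha> L :: "real \<Rightarrow> real" and \<tau> M \<omega> :: real
  assumes complete_range: "complete (energy_map R ` energy_space DR)"
    and B: "bounded_linear B"
    and gradient_lipschitz: "\<And>\<psi> r u v. \<lbrakk>\<psi> \<in> {\<psi>1, \<psi>2}; r > 0; u \<in> DR; v \<in> DR; norm (R u) \<le> r; norm (R v) \<le> r\<rbrakk> \<Longrightarrow>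
          norm (gradient_on DR \<psi> u - gradient_on DR \<psi> v) \<le> L r * norm (R (u - v))"
    and gradient_0: "\<And>\<psi>. \<psi> \<in> {\<psi>1, \<psi>2} \<Longrightarrow> gradient_on DR \<psi> 0 = 0"
    and S: "C0_semigroup_energy DR R S"
    and S_decay: "\<And>t U. t \<ge> 0 \<Longrightarrow> U \<in> energy_space DR \<Longrightarrow>
          energy_norm R (S t U) \<le> M * exp (- \<omega> * t) * energy_norm R U"
    and M_pos: "M > 0" and omega_pos: "\<omega> > 0" and tau_pos: "\<tau> > 0"
    and L_pos: "\<And>r. r > 0 \<Longrightarrow> L r > 0"
    and alpha_L1: "\<And>c. \<alpha> absolutely_integrable_on {0..c}"
begin

definition T :: "real \<Rightarrow> ('h \<times> 'h) banach_copy \<Rightarrow> ('h \<times> 'h) banach_copy" where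
  "T t x = E (S t (E_inv x))"

definition D :: "('h \<times> 'h) banach_copy \<Rightarrow> ('h \<times> 'h) banach_copy" where
  "D x = E (delay_op B (E_inv x))"

definition F :: "('h \<times> 'h) banach_copy \<Rightarrow> ('h \<times> 'h) banach_copy \<Rightarrow> ('h \<times> 'h) banach_copy" where
  "F x y = E (delay_nonlinearity DR \<psi>1 \<psi>2 (E_inv x) (E_inv y))"

definition damping_norm :: real where
  "damping_norm = onorm (\<lambda>x. B (adjoint B x))"

lemma S_in: "t \<ge> 0 \<Longrightarrow> U \<in> es \<Longrightarrow> S t U \<in> es"
  using S by (auto simp: C0_semigroup_energy_def)

lemma T_E [simp]: "U \<in> es \<Longrightarrow> T t (E U) = E (S t U)"
  by (simp add: T_def)

lemma delay_op_in: "delay_op B U \<in> es"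
  unfolding delay_op_def by (rule velocity_in_es)

lemma delay_nonlinearity_in: "delay_nonlinearity DR \<psi>1 \<psi>2 U V \<in> es"
  unfolding delay_nonlinearity_def by (rule velocity_in_es)

lemma damping_bounded_linear: "bounded_linear (\<lambda>x. B (adjoint B x))"
  by (rule bounded_linear_compose[OF B bounded_linear_adjoint[OF B]])

text \<open>The operators are transported along \<open>E\<close>. The first component of the energy norm is the one in
  which the gradients are Lipschitz, the second the one in which \<open>B B\<^sup>*\<close> is bounded.\<close>

sublocale delayed_semilinear "E ` es" T M \<omega> D F \<alpha> L \<tau> damping_norm
proof
  show "closed (E ` es)"
  proof -
    have "E ` es = of_copy -` (energy_map R ` es)"
    proof
      show "of_copy -` (energy_map R ` es) \<subseteq> E ` es"
        by (auto simp: E_def image_iff of_copy_inverse) (metis of_copy_inverse)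
    qed (auto simp: E_def)
    moreover have "closed (of_copy -` (energy_map R ` es))"
      by (intro closed_vimage complete_imp_closed complete_range
          bounded_linear.continuous_on[OF bounded_linear_of_copy] continuous_on_id)
    ultimately show ?thesis
      by simp
  qed
  show "subspace (E ` es)"
    by (rule subspace_range_E)
  show "T t x \<in> E ` es" if "t \<ge> 0" "x \<in> E ` es" for t x
    using that S_in by auto
  show "linear_map_on (E ` es) (T t)" if t: "t \<ge> 0" for t
  proof -
    have lin: "linear_map_on es (S t)"
      using S t by (auto simp: C0_semigroup_energy_def)
    have "T t (E U + E V) = T t (E U) + T t (E V)" if "U \<in> es" "V \<in> es" for U V
      using that lin subspace_add[OF subspace_es that] S_in[OF t]
      by (simp add: linear_map_on_def flip: E_add)
    moreover have "T t (c *\<^sub>R E U) = c *\<^sub>R T t (E U)" if "U \<in> es" for U c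
      using that lin subspace_scale[OF subspace_es that] S_in[OF t]
      by (simp add: linear_map_on_def flip: E_scale)
    ultimately show ?thesis
      unfolding linear_map_on_def by blast
  qed
  show "T 0 x = x" if "x \<in> E ` es" for x
    using that S by (auto simp: C0_semigroup_energy_def)
  show "T (s + t) x = T s (T t x)" if "s \<ge> 0" "t \<ge> 0" "x \<in> E ` es" for s t x
    using that S S_in by (auto simp: C0_semigroup_energy_def)
  show "((\<lambda>t. T t x) \<longlongrightarrow> x) (at_right 0)" if x: "x \<in> E ` es" for x
  proof -
    obtain U where U: "U \<in> es" "x = E U"
      using x by blast
    then have "((\<lambda>t. energy_map R (S t U)) \<longlongrightarrow> energy_map R U) (at_right 0)"
      using S by (auto simp: C0_semigroup_energy_def)
    from bounded_linear.tendsto[OF bounded_linear_to_copy this]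
    have "((\<lambda>t. E (S t U)) \<longlongrightarrow> E U) (at_right 0)"
      unfolding E_def .
    then show ?thesis
      using U by simp
  qed
  show "norm (T t x) \<le> M * exp (- \<omega> * t) * norm x" if "t \<ge> 0" "x \<in> E ` es" for t x
    using that S_decay by (auto simp: norm_E)
  show "D x \<in> E ` es" for x
    unfolding D_def by (intro imageI delay_op_in)
  have delay_op_add: "delay_op B (U + V) = delay_op B U + delay_op B V"
    and delay_op_scale: "delay_op B (c *\<^sub>R U) = c *\<^sub>R delay_op B U" for U V c
    using bounded_linear.linear[OF B] bounded_linear.linear[OF bounded_linear_adjoint[OF B]]
    by (simp_all add: delay_op_def linear_add linear_scale)
  show "linear_map_on (E ` es) D"
  proof -
    have "D (E U + E V) = D (E U) + D (E V)" if "U \<in> es" "V \<in> es" for U V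
      unfolding D_def E_add[OF that, symmetric] using that subspace_add[OF subspace_es that]
      by (simp add: delay_op_add) (simp add: E_add delay_op_in)
    moreover have "D (c *\<^sub>R E U) = c *\<^sub>R D (E U)" if "U \<in> es" for U c
      unfolding D_def E_scale[OF that, symmetric] using that subspace_scale[OF subspace_es that]
      by (simp add: delay_op_scale) (simp add: E_scale delay_op_in)
    ultimately show ?thesis
      unfolding linear_map_on_def by blast
  qed
  show "norm (D x) \<le> damping_norm * norm x" if x: "x \<in> E ` es" for x
  proof -
    obtain U where U: "U \<in> es" "x = E U"
      using x by blast
    have "norm (D x) = norm (B (adjoint B (snd U)))"
      using U by (simp add: D_def delay_op_def norm_E_velocity)
    also have "\<dots> \<le> damping_norm * norm (snd U)"
      using onorm[OF damping_bounded_linear, of "snd U"] by (simp add: damping_norm_def)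
    also have "\<dots> \<le> damping_norm * norm x"
      using onorm_pos_le[OF damping_bounded_linear] norm_snd_le_E[of U] U(2)
      by (intro mult_left_mono) (auto simp: damping_norm_def)
    finally show ?thesis .
  qed
  show "damping_norm \<ge> 0"
    unfolding damping_norm_def by (rule onorm_pos_le[OF damping_bounded_linear])
  show "F x y \<in> E ` es" for x y
    unfolding F_def by (intro imageI delay_nonlinearity_in)
  show "F 0 0 = 0"
  proof -
    have "E 0 = 0"
      using norm_E_velocity[of 0] by (simp add: zero_prod_def)
    moreover from this have "E_inv 0 = 0"
      using E_inv_E[OF subspace_0[OF subspace_es]] by simp
    ultimately show ?thesis
      using gradient_0 by (simp add: F_def delay_nonlinearity_def flip: zero_prod_def)
  qed
  show "norm (F x x' - F y y') \<le> L r * (norm (x - y) + norm (x' - y'))"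
    if r: "r > 0" and sub: "{x, x', y, y'} \<subseteq> E ` es \<inter> cball 0 r" for r x x' y y'
  proof -
    have component: "norm (gradient_on DR \<psi> (fst (E_inv p)) - gradient_on DR \<psi> (fst (E_inv q))) \<le> L r * norm (p - q)"
      if "\<psi> \<in> {\<psi>1, \<psi>2}" "{p, q} \<subseteq> E ` es \<inter> cball 0 r" for \<psi> p q
    proof -
      obtain U V where U: "U \<in> es" "p = E U" and V: "V \<in> es" "q = E V"
        using \<open>{p, q} \<subseteq> E ` es \<inter> cball 0 r\<close> by blast
      have "norm (E U) \<le> r" "norm (E V) \<le> r"
        using that U V by auto
      then have "norm (R (fst U)) \<le> r" "norm (R (fst V)) \<le> r"
        using norm_R_fst_le[of U] norm_R_fst_le[of V] by simp_all
      then have "norm (gradient_on DR \<psi> (fst U) - gradient_on DR \<psi> (fst V)) \<le> L r * norm (R (fst U - fst V))"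
        using U(1) V(1) by (intro gradient_lipschitz that r) (auto simp: energy_space_def)
      also have "\<dots> \<le> L r * norm (E (U - V))"
        using norm_R_fst_le[of "U - V"] L_pos[OF r] by (intro mult_left_mono) auto
      finally show ?thesis
        using U V by (simp add: E_diff)
    qed
    have "F x x' - F y y' = E (0,
          (gradient_on DR \<psi>1 (fst (E_inv x)) - gradient_on DR \<psi>1 (fst (E_inv y)))
          + (gradient_on DR \<psi>2 (fst (E_inv x')) - gradient_on DR \<psi>2 (fst (E_inv y'))))"
      unfolding F_def by (subst E_diff[symmetric])
        (simp_all add: delay_nonlinearity_in, simp add: delay_nonlinearity_def algebra_simps)
    then have "norm (F x x' - F y y')
        = norm ((gradient_on DR \<psi>1 (fst (E_inv x)) - gradient_on DR \<psi>1 (fst (E_inv y)))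
          + (gradient_on DR \<psi>2 (fst (E_inv x')) - gradient_on DR \<psi>2 (fst (E_inv y'))))"
      by (simp only: norm_E_velocity)
    also have "\<dots> \<le> L r * norm (x - y) + L r * norm (x' - y')"
      using sub by (intro norm_triangle_mono component) auto
    finally show ?thesis
      by (simp add: distrib_left)
  qed
qed (use M_pos omega_pos tau_pos L_pos alpha_L1 in auto)

lemma delay_mild_solution_iff:
  assumes \<Phi>: "\<And>s. s \<in> {-\<tau>..0} \<Longrightarrow> \<Phi> s \<in> es" and U: "\<And>t. t \<ge> -\<tau> \<Longrightarrow> U t \<in> es"
  shows "delay_mild_solution DR R B \<psi>1 \<psi>2 S \<alpha> \<tau> \<Phi> U \<longleftrightarrow> solution (\<lambda>s. E (\<Phi> s)) (\<lambda>t. E (U t))"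
proof -
  define g where "g s = \<alpha> s *\<^sub>R delay_op B (U (s - \<tau>)) + delay_nonlinearity DR \<psi>1 \<psi>2 (U s) (U (s - \<tau>))" for s
  have g: "g s \<in> es" for s
    unfolding g_def
    by (intro subspace_add[OF subspace_es] subspace_scale[OF subspace_es] delay_op_in delay_nonlinearity_in)
  have forcing: "T (t - s) (forcing (\<lambda>t. E (U t)) s) = E (S (t - s) (g s))" if "s \<in> {0..t}" for s t
  proof -
    have "forcing (\<lambda>t. E (U t)) s = E (g s)"
      using that tau_pos U[of s] U[of "s - \<tau>"]
      by (simp add: forcing_def g_def F_def D_def E_add E_scale delay_op_in delay_nonlinearity_in
          subspace_scale[OF subspace_es])
    then show ?thesis
      using g by simp
  qed
  have increment: "E (U t - S t (U 0)) = E (U t) - T t (E (U 0))" "U t - S t (U 0) \<in> es" if "t \<ge> 0" for t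
    using that tau_pos U[of t] U[of 0] S_in[of t "U 0"] subspace_diff[OF subspace_es] by (auto simp: E_diff)
  have "energy_has_integral DR R (\<lambda>s. S (t - s) (g s)) (U t - S t (U 0)) {0..t} \<longleftrightarrow>
      ((\<lambda>s. T (t - s) (forcing (\<lambda>t. E (U t)) s)) has_integral (E (U t) - T t (E (U 0)))) {0..t}"
    if "t \<ge> 0" for t
  proof -
    have "((\<lambda>s. T (t - s) (forcing (\<lambda>t. E (U t)) s)) has_integral (E (U t) - T t (E (U 0)))) {0..t}
        \<longleftrightarrow> ((\<lambda>s. E (S (t - s) (g s))) has_integral E (U t - S t (U 0))) {0..t}"
      unfolding increment(1)[OF that] by (intro has_integral_cong forcing)
    also have "\<dots> \<longleftrightarrow> ((\<lambda>s. energy_map R (S (t - s) (g s))) has_integral energy_map R (U t - S t (U 0))) {0..t}"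
      unfolding E_def by (rule has_integral_to_copy_iff)
    finally show ?thesis
      unfolding energy_has_integral_def using increment(2)[OF that] g S_in by auto
  qed
  moreover have "E (U s) = E (\<Phi> s) \<longleftrightarrow> U s = \<Phi> s" if "s \<in> {-\<tau>..0}" for s
    using that E_inj \<Phi> U by (auto simp: inj_on_eq_iff)
  ultimately show ?thesis
    unfolding delay_mild_solution_def solution_def g_def[symmetric] using U
    by (auto simp: E_def continuous_on_to_copy_iff)
qed

end

text \<open>A vector annihilated by the square root lies in the domain of \<open>A\<close> and is annihilated by \<open>A\<close>.\<close>

lemma sqrt_of_positive_injective:
  assumes A: "positive_self_adjoint DA A" and sqrt_A: "op_sqrt_of DA A DR R"
    and u: "u \<in> DR" "R u = 0"
  shows "u = 0"
proof (rule ccontr)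
  assume "u \<noteq> 0"
  have DR: "subspace DR" "linear_map_on DR R"
    using sqrt_A by (auto simp: op_sqrt_of_def self_adjoint_on_def)
  have "R (0 *\<^sub>R 0) = 0 *\<^sub>R R 0"
    using DR subspace_0[OF DR(1)] unfolding linear_map_on_def by blast
  then have R_0: "R 0 = 0"
    by simp
  have "u \<in> DA"
    using sqrt_A u subspace_0[OF DR(1)] by (simp add: op_sqrt_of_def)
  moreover from this have "A u = R (R u)"
    using sqrt_A by (simp add: op_sqrt_of_def)
  ultimately show False
    using A \<open>u \<noteq> 0\<close> u R_0 by (fastforce simp: positive_self_adjoint_def)
qed

context delayed_wave begin

text \<open>By \<open>growth_le\<close> the envelope \<open>K * exp (- \<omega> t + growth r t)\<close> never exceeds \<open>K * exp G\<close>, so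
  \<open>K = r * exp (- G)\<close> keeps it below \<open>r\<close>. The radius \<open>\<rho>\<close> has to make both the history and \<open>M\<close> times
  the initial value at most \<open>K\<close>.\<close>

lemma small_data_global_solution:
  assumes r: "r > 0"
    and delayed: "\<forall>t>0.
          M * damping_norm * exp (\<omega> * \<tau>) * integral {0..t} (\<lambda>s. \<bar>\<alpha> (s + \<tau>)\<bar>) \<le> \<gamma> + \<omega>' * t"
    and gamma: "\<gamma> \<ge> 0" and L: "M * L r * (1 + exp (\<omega> * \<tau>)) \<le> \<omega> - \<omega>'"
  shows "\<exists>\<rho>>0. \<forall>\<Phi>.
       (\<forall>s\<in>{-\<tau>..0}. \<Phi> s \<in> es) \<longrightarrow>
       continuous_on {-\<tau>..0} (\<lambda>s. energy_map R (\<Phi> s)) \<longrightarrow>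
       (\<forall>s\<in>{-\<tau>..0}. energy_norm R (\<Phi> s) \<le> \<rho>) \<longrightarrow>
       (\<exists>U. delay_mild_solution DR R B \<psi>1 \<psi>2 S \<alpha> \<tau> \<Phi> U \<and>
            (\<forall>V. delay_mild_solution DR R B \<psi>1 \<psi>2 S \<alpha> \<tau> \<Phi> V \<longrightarrow> (\<forall>t\<ge>-\<tau>. V t = U t)) \<and>
            (\<forall>t\<ge>0. energy_norm R (U t) \<le> r))"
proof -
  define G where "G = M * damping_norm * exp (\<omega> * \<tau>) * integral {0..\<tau>} (\<lambda>s. \<bar>\<alpha> s\<bar>) + \<gamma>"
  define K where "K = r * exp (- G)"
  define \<rho> where "\<rho> = K / (1 + M)"
  have K_pos: "K > 0"
    using r by (simp add: K_def)
  have rho: "\<rho> > 0" "\<rho> \<le> K" "M * \<rho> \<le> K"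
    using K_pos M_pos by (simp_all add: \<rho>_def field_simps)
  have envelope: "K * exp (- \<omega> * t + growth r t) \<le> r" if "t \<ge> 0" for t
  proof -
    have "- \<omega> * t + growth r t \<le> G"
      using growth_le[OF r that delayed[rule_format] gamma L] by (simp add: G_def)
    then have "K * exp (- \<omega> * t + growth r t) \<le> K * exp G"
      using K_pos by simp
    also have "K * exp G = r"
      by (simp add: K_def mult.assoc flip: exp_add)
    finally show ?thesis .
  qed
  have "\<exists>U. delay_mild_solution DR R B \<psi>1 \<psi>2 S \<alpha> \<tau> \<Phi> U \<and>
      (\<forall>V. delay_mild_solution DR R B \<psi>1 \<psi>2 S \<alpha> \<tau> \<Phi> V \<longrightarrow> (\<forall>t\<ge>-\<tau>. V t = U t)) \<and>
      (\<forall>t\<ge>0. energy_norm R (U t) \<le> r)"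
    if Phi: "\<And>s. s \<in> {-\<tau>..0} \<Longrightarrow> \<Phi> s \<in> es"
      and cont: "continuous_on {-\<tau>..0} (\<lambda>s. energy_map R (\<Phi> s))"
      and small: "\<And>s. s \<in> {-\<tau>..0} \<Longrightarrow> energy_norm R (\<Phi> s) \<le> \<rho>" for \<Phi>
  proof -
    have "\<exists>W. solution (\<lambda>s. E (\<Phi> s)) W \<and> range W \<subseteq> E ` es \<and> (\<forall>t\<ge>0. norm (W t) \<le> r)"
    proof (rule global_solution_exists[OF r])
      show "continuous_on {-\<tau>..0} (\<lambda>s. E (\<Phi> s))"
        unfolding E_def continuous_on_to_copy_iff by (rule cont)
      show "(\<lambda>s. E (\<Phi> s)) ` {-\<tau>..0} \<subseteq> E ` es"
        using Phi by auto
      show "norm (E (\<Phi> s)) \<le> K" if "s \<in> {-\<tau>..0}" for s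
        using small[OF that] rho(2) by (simp add: norm_E)
      have "M * norm (E (\<Phi> 0)) \<le> M * \<rho>"
        using small[of 0] tau_pos M_pos by (simp add: norm_E)
      then show "M * norm (E (\<Phi> 0)) \<le> K"
        using rho(3) by simp
    qed (rule envelope)
    then obtain W where W: "solution (\<lambda>s. E (\<Phi> s)) W" "range W \<subseteq> E ` es" "\<And>t. t \<ge> 0 \<Longrightarrow> norm (W t) \<le> r"
      by blast
    define U where "U t = E_inv (W t)" for t
    have U: "U t \<in> es" "E (U t) = W t" for t
    proof -
      obtain u where "u \<in> es" "W t = E u"
        using W(2) by blast
      then show "U t \<in> es" "E (U t) = W t"
        by (simp_all add: U_def)
    qed
    have sol: "delay_mild_solution DR R B \<psi>1 \<psi>2 S \<alpha> \<tau> \<Phi> U"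
      using delay_mild_solution_iff[of \<Phi> U] Phi U W(1) by simp
    moreover have "V t = U t" if V: "delay_mild_solution DR R B \<psi>1 \<psi>2 S \<alpha> \<tau> \<Phi> V" and t: "t \<ge> -\<tau>" for V t
    proof -
      have V_in: "V s \<in> es" if "s \<ge> -\<tau>" for s
        using V that by (simp add: delay_mild_solution_def)
      then have "solution (\<lambda>s. E (\<Phi> s)) (\<lambda>t. E (V t))"
        using delay_mild_solution_iff[of \<Phi> V] Phi V by simp
      from solution_unique[OF this W(1) t] have "E (V t) = E (U t)"
        using U by simp
      then show ?thesis
        using inj_onD[OF E_inj] V_in[OF t] U(1) by blast
    qed
    moreover have "energy_norm R (U t) \<le> r" if "t \<ge> 0" for t
      using W(3)[OF that] U(2) by (simp flip: norm_E)
    ultimately show ?thesis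
      by blast
  qed
  then show ?thesis
    using rho(1) by (intro exI[of _ \<rho>]) simp
qed

end

theorem theorem2p6:
  fixes DA DR :: "'h::{real_inner,complete_space} set"
    and A R B :: "'h \<Rightarrow> 'h"
    and C :: "'w::{real_inner,complete_space} \<Rightarrow> 'h"
    and \<psi>1 \<psi>2 :: "'h \<Rightarrow> real"
    and S :: "real \<Rightarrow> 'h \<times> 'h \<Rightarrow> 'h \<times> 'h"
    and \<alpha> L h1 :: "real \<Rightarrow> real"
    and \<tau> \<sigma> M \<omega> b \<gamma> \<omega>' :: real
  assumes A: "positive_self_adjoint DA A"
    and sqrt_A: "op_sqrt_of DA A DR R"
    and Hilbert: "complete (energy_map R ` energy_space DR)"
    and B: "bounded_linear B" and C: "bounded_linear C"
    and tau: "\<tau> > 0"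
    and alpha_neg: "\<And>s. s < 0 \<Longrightarrow> \<alpha> s = 0"
    and alpha_loc: "\<And>T. T \<ge> 0 \<Longrightarrow> \<alpha> absolutely_integrable_on {0..T}"
    and sigma: "\<sigma> > 0" "\<And>t. t \<ge> 0 \<Longrightarrow> integral {t - \<tau>..t} (\<lambda>s. \<bar>\<alpha> s\<bar>) \<le> \<sigma>"
    and observability: "\<exists>T0>0. \<exists>c>0. \<forall>w v. damped_wave_solution DR R C w v \<longrightarrow>
          integral {0..T0} (\<lambda>t. (norm (adjoint C (v t)))\<^sup>2) \<ge> c * ((norm (v 0))\<^sup>2 + (norm (R (w 0)))\<^sup>2)"
    and psi_diff: "\<And>\<psi>. \<psi> \<in> {\<psi>1, \<psi>2} \<Longrightarrow> gateaux_differentiable_on DR \<psi>"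
    and psi_bdd: "\<And>\<psi> u. \<psi> \<in> {\<psi>1, \<psi>2} \<Longrightarrow> u \<in> DR \<Longrightarrow>
          \<exists>c>0. \<forall>v\<in>DR. \<bar>gateaux_deriv \<psi> u v\<bar> \<le> c * norm v"
    and L_pos: "\<And>r. r > 0 \<Longrightarrow> L r > 0"
    and psi_lip: "\<And>\<psi> r u v. \<lbrakk>\<psi> \<in> {\<psi>1, \<psi>2}; r > 0; u \<in> DR; v \<in> DR; norm (R u) \<le> r; norm (R v) \<le> r\<rbrakk> \<Longrightarrow>
          norm (gradient_on DR \<psi> u - gradient_on DR \<psi> v) \<le> L r * norm (R (u - v))"
    and L_lim: "(L \<longlongrightarrow> 0) (at_right 0)"
    and psi_0: "\<And>\<psi>. \<psi> \<in> {\<psi>1, \<psi>2} \<Longrightarrow> \<psi> 0 = 0 \<and> gradient_on DR \<psi> 0 = 0"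
    and h1: "strict_mono_on {0..} h1" "continuous_on {0..} h1"
          "\<And>u. u \<in> DR \<Longrightarrow> \<bar>gradient_on DR \<psi>1 u \<bullet> u\<bar> \<le> h1 (norm (R u)) * (norm (R u))\<^sup>2"
    and S: "generates_energy DR R (DA \<times> DR) (wave_op A C) S"
    and M_omega: "M > 0" "\<omega> > 0"
    and S_decay: "\<And>t U. t \<ge> 0 \<Longrightarrow> U \<in> energy_space DR \<Longrightarrow>
          energy_norm R (S t U) \<le> M * exp (- \<omega> * t) * energy_norm R U"
    and b: "b = onorm (\<lambda>x. B (adjoint B x))"
    and gamma: "\<gamma> \<ge> 0" and omega': "0 \<le> \<omega>'" "\<omega>' < \<omega>"
    and alpha_growth: "\<And>t. t > 0 \<Longrightarrow>
          M * b * exp (\<omega> * \<tau>) * integral {0..t} (\<lambda>s. \<bar>\<alpha> (s + \<tau>)\<bar>) \<le> \<gamma> + \<omega>' * t"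
  shows "\<exists>\<rho>>0. \<exists>C\<rho>>0. L C\<rho> < (\<omega> - \<omega>') / (M * (1 + exp (\<omega> * \<tau>))) \<and>
    (\<forall>f0 g0. let \<Phi> = (\<lambda>s. (f0 s, g0 s)) in
       (\<forall>s\<in>{-\<tau>..0}. \<Phi> s \<in> energy_space DR) \<longrightarrow>
       continuous_on {-\<tau>..0} (\<lambda>s. energy_map R (\<Phi> s)) \<longrightarrow>
       (norm (g0 0))\<^sup>2 + (norm (R (f0 0)))\<^sup>2
         + integral {-\<tau>..0} (\<lambda>s. (norm (gradient_on DR \<psi>2 (f0 s)))\<^sup>2)
         + integral {-\<tau>..0} (\<lambda>s. \<bar>\<alpha> (s + \<tau>)\<bar> * (norm (adjoint B (g0 s)))\<^sup>2) < \<rho>\<^sup>2 \<longrightarrow>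
       (SUP s\<in>{-\<tau>..0}. energy_norm R (\<Phi> s)) < \<rho> \<longrightarrow>
       (\<exists>U. delay_mild_solution DR R B \<psi>1 \<psi>2 S \<alpha> \<tau> \<Phi> U \<and>
            (\<forall>V. delay_mild_solution DR R B \<psi>1 \<psi>2 S \<alpha> \<tau> \<Phi> V \<longrightarrow> (\<forall>t\<ge>-\<tau>. V t = U t)) \<and>
            (\<forall>t\<ge>0. energy_norm R (U t) \<le> C\<rho>)))"
proof -
  have DR: "subspace DR" "linear_map_on DR R"
    using sqrt_A by (auto simp: op_sqrt_of_def self_adjoint_on_def)
  have alpha_L1: "\<alpha> absolutely_integrable_on {0..c}" for c
    using alpha_loc[of c] by (cases "c \<ge> 0") (auto simp: absolutely_integrable_on_def)
  have gradient_0: "gradient_on DR \<psi> 0 = 0" if "\<psi> \<in> {\<psi>1, \<psi>2}" for \<psi>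
    using psi_0[OF that] by blast
  have semigroup: "C0_semigroup_energy DR R S"
    using S by (simp add: generates_energy_def)
  interpret delayed_wave DR R B \<psi>1 \<psi>2 S \<alpha> L \<tau> M \<omega>
    by (intro delayed_wave.intro energy_isometry.intro delayed_wave_axioms.intro)
      (fact DR sqrt_of_positive_injective[OF A sqrt_A] Hilbert B psi_lip gradient_0 semigroup S_decay
        M_omega tau L_pos alpha_L1)+
  let ?bound = "(\<omega> - \<omega>') / (M * (1 + exp (\<omega> * \<tau>)))"
  have denominator: "M * (1 + exp (\<omega> * \<tau>)) > 0"
    using M_omega(1) by (simp add: add_pos_pos)
  then have "?bound > 0"
    using omega' by simp
  then have "\<forall>\<^sub>F r in at_right 0. L r < ?bound"
    by (rule order_tendstoD(2)[OF L_lim])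
  then obtain r where r: "r > 0" "L r < ?bound"
    unfolding eventually_at_right_field using dense by metis
  have L_r: "M * L r * (1 + exp (\<omega> * \<tau>)) \<le> \<omega> - \<omega>'"
    using r(2) denominator by (simp add: pos_less_divide_eq mult_ac)
  have delayed: "\<forall>t>0. M * damping_norm * exp (\<omega> * \<tau>) * integral {0..t} (\<lambda>s. \<bar>\<alpha> (s + \<tau>)\<bar>) \<le> \<gamma> + \<omega>' * t"
    using alpha_growth by (simp add: damping_norm_def b)
  from small_data_global_solution[OF r(1) delayed gamma L_r]
  obtain \<rho> where rho: "\<rho> > 0" and solvable: "\<forall>\<Phi>.
       (\<forall>s\<in>{-\<tau>..0}. \<Phi> s \<in> energy_space DR) \<longrightarrow>
       continuous_on {-\<tau>..0} (\<lambda>s. energy_map R (\<Phi> s)) \<longrightarrow>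
       (\<forall>s\<in>{-\<tau>..0}. energy_norm R (\<Phi> s) \<le> \<rho>) \<longrightarrow>
       (\<exists>U. delay_mild_solution DR R B \<psi>1 \<psi>2 S \<alpha> \<tau> \<Phi> U \<and>
            (\<forall>V. delay_mild_solution DR R B \<psi>1 \<psi>2 S \<alpha> \<tau> \<Phi> V \<longrightarrow> (\<forall>t\<ge>-\<tau>. V t = U t)) \<and>
            (\<forall>t\<ge>0. energy_norm R (U t) \<le> r))"
    by (elim exE conjE)
  have below_sup: "energy_norm R (\<Phi> s) \<le> \<rho>"
    if cont: "continuous_on {-\<tau>..0} (\<lambda>s. energy_map R (\<Phi> s))"
      and sup: "(SUP s\<in>{-\<tau>..0}. energy_norm R (\<Phi> s)) < \<rho>" and s: "s \<in> {-\<tau>..0}" for \<Phi> s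
  proof -
    have "compact ((\<lambda>s. energy_norm R (\<Phi> s)) ` {-\<tau>..0})"
      unfolding norm_energy_map[symmetric]
      by (intro compact_continuous_image continuous_on_norm cont) auto
    then have "bdd_above ((\<lambda>s. energy_norm R (\<Phi> s)) ` {-\<tau>..0})"
      by (intro bounded_imp_bdd_above compact_imp_bounded)
    from cSUP_upper[OF s this] sup show ?thesis
      by simp
  qed
  show ?thesis
    unfolding Let_def
  proof (rule exI[of _ \<rho>], rule conjI[OF rho], rule exI[of _ r], intro conjI allI impI r)
    fix f0 g0
    assume "\<forall>s\<in>{-\<tau>..0}. (f0 s, g0 s) \<in> energy_space DR"
      and cont: "continuous_on {-\<tau>..0} (\<lambda>s. energy_map R (f0 s, g0 s))"
      and sup: "(SUP s\<in>{-\<tau>..0}. energy_norm R (f0 s, g0 s)) < \<rho>"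
    then show "\<exists>U. delay_mild_solution DR R B \<psi>1 \<psi>2 S \<alpha> \<tau> (\<lambda>s. (f0 s, g0 s)) U \<and>
            (\<forall>V. delay_mild_solution DR R B \<psi>1 \<psi>2 S \<alpha> \<tau> (\<lambda>s. (f0 s, g0 s)) V \<longrightarrow> (\<forall>t\<ge>-\<tau>. V t = U t)) \<and>
            (\<forall>t\<ge>0. energy_norm R (U t) \<le> r)"
      by (intro solvable[THEN spec, THEN mp, THEN mp, THEN mp] ballI below_sup[OF cont sup]) blast
  qed
qed

end
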